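(* Let $(Q,\lhd)$ be a quandle, $R$ a commutative ring, $A$ an $R$-module, $\alpha\in R^*$ a unit, and $\omega\colon Q\times Q\to A$ an $\alpha$-twisted quandle $2$-cocycle. Regard $\mathbb{Z}$ as a $Q$-module via $m\lhd a=m+1$, and let $\omega_\alpha\colon \mathbb{Z}\times Q\times Q\to A$, $\omega_\alpha(m,a,b)=\alpha^{-m}\omega(a,b)$. Then for every knot diagram $D$, the multiset $\{\,\mathcal{W}^{tw}_\omega(D,\mathcal{C},\alpha)\mid \mathcal{C}\in\mathscr{C}_Q(D)\,\}$ of $\alpha$-twisted $\omega$-weights of $D$ coincides with the multiset $$\{\,\mathcal{W}^{sh}_{\omega_\alpha}(D,\mathcal{C},\mathcal{C}^{sh})\mid (\mathcal{C},\mathcal{C}^{sh})\in\mathscr{C}^{sh}_{Q,\mathbb{Z}}(D),\ \mathcal{C}^{sh}(\Delta_{ex}(D))=0\,\}$$ of its $\mathbb{Z}$-shadow $\omega_\alpha$-weights with the exterior region colored by $0$.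
   Context: Quandle: a set $Q$ with operations $\lhd,\widetilde{\lhd}$ such that $(a\lhd b)\lhd c=(a\lhd c)\lhd(b\lhd c)$, $(a\lhd b)\,\widetilde{\lhd}\,b=(a\,\widetilde{\lhd}\,b)\lhd b=a$, $a\lhd a=a$ for all $a,b,c\in Q$. A $Q$-module is a set $M$ with maps $\lhd,\widetilde{\lhd}\colon M\times Q\to M$ satisfying $(m\lhd b)\lhd c=(m\lhd c)\lhd(b\lhd c)$ and $(m\lhd b)\,\widetilde{\lhd}\,b=(m\,\widetilde{\lhd}\,b)\lhd b=m$ for $m\in M$, $b,c\in Q$. Knots: "knot" means oriented knot or link in $\mathbb{R}^3$; a knot diagram $D$ is a diagram in $\mathbb{R}^2$ of such a link. Arcs run from undercrossing to undercrossing (or are closed curves). Regions are the connected components of $\mathbb{R}^2\setminus D$; $\Delta_{ex}(D)$ is the exterior (unbounded) region. Left and right of an oriented arc are as seen when travelling along it. Colorings: a $Q$-coloring $\mathcal{C}$ of $D$ assigns an element of $Q$ to each arc such that at each crossing, if the over-arc has color $b$ and the under-arc on the right of the over-arc has color $a$, then the under-arc on the left of the over-arc has color $a\lhd b$. The set of $Q$-colorings is $\mathscr{C}_Q(D)$. A (shadow) $(Q,M)$-coloring is a pair $(\mathcal{C},\mathcal{C}^{sh})$ with $\mathcal{C}\in\mathscr{C}_Q(D)$ and $\mathcal{C}^{sh}$ an assignment of elements of $M$ to regions such that whenever the region on the right of an arc colored $a$ has color $m$, the adjacent region on its left has color $m\lhd a$. The set of these is $\mathscr{C}^{sh}_{Q,M}(D)$.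 Indices: the index $i(\Delta)$ of a region $\Delta$ is the algebraic intersection number of $D$ with a path from $\Delta$ to $\Delta_{ex}(D)$ (finitely many simple transverse intersections), where a crossing of the path over $D$ from the left side to the right side of the oriented $D$ counts $+1$ and from right to left counts $-1$. The source region $\Delta(x)$ of a crossing $x$ is the one of the four regions at $x$ lying on the right of both strands. Put $i(x)=i(\Delta(x))$. Weights: for a crossing $x$, $\varepsilon(x)=\pm1$ is its usual sign, $b_x$ is the color of the over-arc and $a_x$ the color of the under-arc lying on the right of the over-arc. The $\alpha$-twisted $\omega$-weight is $\mathcal{W}^{tw}_\omega(D,\mathcal{C},\alpha)=\sum_x\varepsilon(x)\alpha^{-i(x)}\omega(a_x,b_x)$, and for $\phi\colon M\times Q\times Q\to A$ the shadow $\phi$-weight is $\mathcal{W}^{sh}_\phi(D,\mathcal{C},\mathcal{C}^{sh})=\sum_x\varepsilon(x)\,\phi(\mathcal{C}^{sh}(\Delta(x)),a_x,b_x)$, sums over all crossings. An $\alpha$-twisted quandle $2$-cocycle is a map $\omega\colon Q\times Q\to A$ with $\omega(a,a)=0$ and $\omega(a\lhd c,b\lhd c)-\alpha\omega(a,b)-\omega(a\lhd b,c)+\alpha\omega(a,c)+(1-\alpha)\omega(b,c)=0$ for all $a,b,c$. Two multisets given as indexed families coincide if there is a bijection of index sets preserving values. *)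

theory Defs
  imports "HOL-Analysis.Analysis" "HOL-Algebra.Module"
begin

section \<open>Quandles, modules over quandles, twisted cocycles\<close>

definition quandle :: "'q set \<Rightarrow> ('q \<Rightarrow> 'q \<Rightarrow> 'q) \<Rightarrow> ('q \<Rightarrow> 'q \<Rightarrow> 'q) \<Rightarrow> bool" where
  "quandle Q op op' \<longleftrightarrow>
     (\<forall>a\<in>Q. \<forall>b\<in>Q. op a b \<in> Q \<and> op' a b \<in> Q) \<and>
     (\<forall>a\<in>Q. \<forall>b\<in>Q. \<forall>c\<in>Q. op (op a b) c = op (op a c) (op b c)) \<and>
     (\<forall>a\<in>Q. \<forall>b\<in>Q. op' (op a b) b = a \<and> op (op' a b) b = a) \<and>
     (\<forall>a\<in>Q. op a a = a)"

definition quandle_module ::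
  "'q set \<Rightarrow> ('q \<Rightarrow> 'q \<Rightarrow> 'q) \<Rightarrow> 'm set \<Rightarrow> ('m \<Rightarrow> 'q \<Rightarrow> 'm) \<Rightarrow> ('m \<Rightarrow> 'q \<Rightarrow> 'm) \<Rightarrow> bool" where
  "quandle_module Q op M act act' \<longleftrightarrow>
     (\<forall>m\<in>M. \<forall>b\<in>Q. act m b \<in> M \<and> act' m b \<in> M) \<and>
     (\<forall>m\<in>M. \<forall>b\<in>Q. \<forall>c\<in>Q. act (act m b) c = act (act m c) (op b c)) \<and>
     (\<forall>m\<in>M. \<forall>b\<in>Q. act' (act m b) b = m \<and> act (act' m b) b = m)"

definition int_act :: "int \<Rightarrow> 'q \<Rightarrow> int" where
  "int_act m a = m + 1"

lemma quandle_module_int: "quandle_module Q op UNIV int_act (\<lambda>m a. m - 1)"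
  by (simp add: quandle_module_def int_act_def)

definition twisted_2_cocycle ::
  "'q set \<Rightarrow> ('q \<Rightarrow> 'q \<Rightarrow> 'q) \<Rightarrow> ('r, 'k) ring_scheme \<Rightarrow> ('r, 'a, 'l) module_scheme \<Rightarrow>
   'r \<Rightarrow> ('q \<Rightarrow> 'q \<Rightarrow> 'a) \<Rightarrow> bool" where
  "twisted_2_cocycle Q op R A \<alpha> \<omega> \<longleftrightarrow>
     (\<forall>a\<in>Q. \<forall>b\<in>Q. \<omega> a b \<in> carrier A) \<and>
     (\<forall>a\<in>Q. \<omega> a a = \<zero>\<^bsub>A\<^esub>) \<and>
     (\<forall>a\<in>Q. \<forall>b\<in>Q. \<forall>c\<in>Q.
        \<omega> (op a c) (op b c) \<ominus>\<^bsub>A\<^esub> \<alpha> \<odot>\<^bsub>A\<^esub> \<omega> a b \<ominus>\<^bsub>A\<^esub> \<omega> (op a b) c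
          \<oplus>\<^bsub>A\<^esub> \<alpha> \<odot>\<^bsub>A\<^esub> \<omega> a c \<oplus>\<^bsub>A\<^esub> (\<one>\<^bsub>R\<^esub> \<ominus>\<^bsub>R\<^esub> \<alpha>) \<odot>\<^bsub>A\<^esub> \<omega> b c = \<zero>\<^bsub>A\<^esub>)"

definition shadow_map_of_twisted ::
  "('r, 'k) ring_scheme \<Rightarrow> ('r, 'a, 'l) module_scheme \<Rightarrow> 'r \<Rightarrow> ('q \<Rightarrow> 'q \<Rightarrow> 'a) \<Rightarrow>
   int \<Rightarrow> 'q \<Rightarrow> 'q \<Rightarrow> 'a" where
  "shadow_map_of_twisted R A \<alpha> \<omega> m a b = (\<alpha> [^]\<^bsub>R\<^esub> (- m)) \<odot>\<^bsub>A\<^esub> \<omega> a b"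

section \<open>Knot diagrams in the plane\<close>

text \<open>The plane is \<^typ>\<open>complex\<close>. The components of the link project to the closed curves
  \<open>curve D i\<close> for \<open>i < ncomp D\<close>, each of them a 1-periodic map on the real line whose direction
  of travel is the orientation. A parameter is a pair \<open>(i, t)\<close> with \<open>0 \<le> t < 1\<close>, and \<open>under D\<close>
  consists of the parameters at which a curve passes under another strand; this records the
  crossing information.\<close>

record diagram =
  ncomp :: nat
  curve :: "nat \<Rightarrow> real \<Rightarrow> complex"
  under :: "(nat \<times> real) set"

definition params :: "diagram \<Rightarrow> (nat \<times> real) set" where
  "params D = {..<ncomp D} \<times> {0..<1}"

definition pt :: "diagram \<Rightarrow> nat \<times> real \<Rightarrow> complex" where
  "pt D q = curve D (fst q) (snd q)"

definition vel :: "diagram \<Rightarrow> nat \<times> real \<Rightarrow> complex" where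
  "vel D q = vector_derivative (curve D (fst q)) (at (snd q))"

definition regular :: "diagram \<Rightarrow> nat \<times> real \<Rightarrow> bool" where
  "regular D q \<longleftrightarrow>
     (\<exists>d>0. curve D (fst q) C1_differentiable_on {snd q - d<..<snd q + d}) \<and> vel D q \<noteq> 0"

definition diagram_image :: "diagram \<Rightarrow> complex set" where
  "diagram_image D = pt D ` params D"

text \<open>\<open>cross2 u w\<close> is the determinant of \<open>(u, w)\<close>: it is positive iff \<open>w\<close> points to the left of
  the direction \<open>u\<close>, and negative iff \<open>w\<close> points to the right.\<close>

definition cross2 :: "complex \<Rightarrow> complex \<Rightarrow> real" where
  "cross2 u w = Re u * Im w - Im u * Re w"

definition crossings :: "diagram \<Rightarrow> complex set" where
  "crossings D = {x. \<exists>q\<in>params D. \<exists>q'\<in>params D. q \<noteq> q' \<and> pt D q = x \<and> pt D q' = x}"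

text \<open>Finitely many non-regular parameters (corners) are allowed away from the crossings, so
  that smooth as well as polygonal diagrams are covered. All multiple points are transverse double
  points with exactly one under-strand.\<close>

definition knot_diagram :: "diagram \<Rightarrow> bool" where
  "knot_diagram D \<longleftrightarrow>
     (\<forall>i<ncomp D. continuous_on UNIV (curve D i) \<and> (\<forall>t. curve D i (t + 1) = curve D i t)) \<and>
     finite {q \<in> params D. \<not> regular D q} \<and>
     finite (crossings D) \<and>
     (\<forall>x\<in>crossings D. card {q \<in> params D. pt D q = x} = 2) \<and>
     (\<forall>q\<in>params D. \<forall>q'\<in>params D. q \<noteq> q' \<and> pt D q = pt D q' \<longrightarrow>
        regular D q \<and> regular D q' \<and> cross2 (vel D q) (vel D q') \<noteq> 0 \<and>
        (q \<in> under D \<longleftrightarrow> q' \<notin> under D)) \<and>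
     under D \<subseteq> {q \<in> params D. pt D q \<in> crossings D}"

section \<open>Arcs and crossings\<close>

text \<open>An arc is encoded by its set of parameters: \<open>arc_of D q\<close> is obtained by moving from \<open>q\<close>
  along the curve in both directions without meeting an undercrossing. The underlying interval
  lives on the real line and is reduced modulo 1; a component without undercrossings yields a
  single, closed arc.\<close>

definition arc_of :: "diagram \<Rightarrow> nat \<times> real \<Rightarrow> (nat \<times> real) set" where
  "arc_of D q =
     (\<lambda>s. (fst q, frac s)) ` connected_component_set {s. (fst q, frac s) \<notin> under D} (snd q)"

definition arcs :: "diagram \<Rightarrow> (nat \<times> real) set set" where
  "arcs D = arc_of D ` (params D - under D)"

definition under_param :: "diagram \<Rightarrow> complex \<Rightarrow> nat \<times> real" where
  "under_param D x = (THE q. q \<in> params D \<and> q \<in> under D \<and> pt D q = x)"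

definition over_param :: "diagram \<Rightarrow> complex \<Rightarrow> nat \<times> real" where
  "over_param D x = (THE q. q \<in> params D \<and> q \<notin> under D \<and> pt D q = x)"

definition over_arc :: "diagram \<Rightarrow> complex \<Rightarrow> (nat \<times> real) set" where
  "over_arc D x = arc_of D (over_param D x)"

definition under_arc_in :: "diagram \<Rightarrow> complex \<Rightarrow> (nat \<times> real) set" where
  "under_arc_in D x = (case under_param D x of (i, t) \<Rightarrow>
     THE a. a \<in> arcs D \<and> (\<forall>\<^sub>F s in at_right 0. (i, frac (t - s)) \<in> a))"

definition under_arc_out :: "diagram \<Rightarrow> complex \<Rightarrow> (nat \<times> real) set" where
  "under_arc_out D x = (case under_param D x of (i, t) \<Rightarrow>
     THE a. a \<in> arcs D \<and> (\<forall>\<^sub>F s in at_right 0. (i, frac (t + s)) \<in> a))"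

text \<open>The crossing is positive iff the under-strand travels from the right to the left of the
  over-strand.\<close>

definition positive_crossing :: "diagram \<Rightarrow> complex \<Rightarrow> bool" where
  "positive_crossing D x \<longleftrightarrow> cross2 (vel D (over_param D x)) (vel D (under_param D x)) > 0"

definition crossing_sign :: "diagram \<Rightarrow> complex \<Rightarrow> int" where
  "crossing_sign D x = (if positive_crossing D x then 1 else - 1)"

definition under_arc_right :: "diagram \<Rightarrow> complex \<Rightarrow> (nat \<times> real) set" where
  "under_arc_right D x =
     (if positive_crossing D x then under_arc_in D x else under_arc_out D x)"

definition under_arc_left :: "diagram \<Rightarrow> complex \<Rightarrow> (nat \<times> real) set" where
  "under_arc_left D x =
     (if positive_crossing D x then under_arc_out D x else under_arc_in D x)"

section \<open>Regions and their indices\<close>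

definition regions :: "diagram \<Rightarrow> complex set set" where
  "regions D = components (- diagram_image D)"

definition exterior_region :: "diagram \<Rightarrow> complex set" where
  "exterior_region D = (THE \<Delta>. \<Delta> \<in> regions D \<and> \<not> bounded \<Delta>)"

definition region_towards :: "diagram \<Rightarrow> complex \<Rightarrow> complex \<Rightarrow> complex set" where
  "region_towards D z w =
     (THE \<Delta>. \<Delta> \<in> regions D \<and> (\<forall>\<^sub>F \<epsilon> in at_right 0. z + of_real \<epsilon> * w \<in> \<Delta>))"

text \<open>Multiplication by \<open>\<i>\<close> turns the direction of travel to the left.\<close>

definition left_region :: "diagram \<Rightarrow> nat \<times> real \<Rightarrow> complex set" where
  "left_region D q = region_towards D (pt D q) (\<i> * vel D q)"

definition right_region :: "diagram \<Rightarrow> nat \<times> real \<Rightarrow> complex set" where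
  "right_region D q = region_towards D (pt D q) (- \<i> * vel D q)"

definition source_region :: "diagram \<Rightarrow> complex \<Rightarrow> complex set" where
  "source_region D x =
     (THE \<Delta>. \<Delta> \<in> regions D \<and>
        (\<exists>w. cross2 (vel D (over_param D x)) w < 0 \<and> cross2 (vel D (under_param D x)) w < 0 \<and>
             (\<forall>\<^sub>F \<epsilon> in at_right 0. x + of_real \<epsilon> * w \<in> \<Delta>)))"

definition param_of :: "diagram \<Rightarrow> complex \<Rightarrow> nat \<times> real" where
  "param_of D z = (THE q. q \<in> params D \<and> pt D q = z)"

definition meeting_times :: "diagram \<Rightarrow> (real \<Rightarrow> complex) \<Rightarrow> real set" where
  "meeting_times D \<beta> = {s \<in> {0..1}. \<beta> s \<in> diagram_image D}"

definition transverse_path :: "diagram \<Rightarrow> (real \<Rightarrow> complex) \<Rightarrow> bool" where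
  "transverse_path D \<beta> \<longleftrightarrow>
     path \<beta> \<and> finite (meeting_times D \<beta>) \<and>
     (\<forall>s\<in>meeting_times D \<beta>.
        \<beta> s \<notin> crossings D \<and> regular D (param_of D (\<beta> s)) \<and> \<beta> differentiable (at s) \<and>
        cross2 (vel D (param_of D (\<beta> s))) (vector_derivative \<beta> (at s)) \<noteq> 0)"

text \<open>The path passes from the left to the right side of the diagram, which counts \<open>+1\<close>, iff its
  velocity points to the right of the velocity of the diagram.\<close>

definition intersection_number :: "diagram \<Rightarrow> (real \<Rightarrow> complex) \<Rightarrow> int" where
  "intersection_number D \<beta> =
     (\<Sum>s\<in>meeting_times D \<beta>.
        if cross2 (vel D (param_of D (\<beta> s))) (vector_derivative \<beta> (at s)) < 0 then 1 else - 1)"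

definition region_index :: "diagram \<Rightarrow> complex set \<Rightarrow> int" where
  "region_index D \<Delta> =
     (THE k. \<exists>\<beta>. transverse_path D \<beta> \<and> pathstart \<beta> \<in> \<Delta> \<and> pathfinish \<beta> \<in> exterior_region D \<and>
        k = intersection_number D \<beta>)"

definition crossing_index :: "diagram \<Rightarrow> complex \<Rightarrow> int" where
  "crossing_index D x = region_index D (source_region D x)"

section \<open>Colorings and weights\<close>

text \<open>Colorings are extensional functions, so that distinct elements of the sets below are
  distinct assignments of colors.\<close>

definition colorings ::
  "'q set \<Rightarrow> ('q \<Rightarrow> 'q \<Rightarrow> 'q) \<Rightarrow> diagram \<Rightarrow> ((nat \<times> real) set \<Rightarrow> 'q) set" where
  "colorings Q op D =
     {\<C> \<in> arcs D \<rightarrow>\<^sub>E Q. \<forall>x\<in>crossings D.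
        \<C> (under_arc_left D x) = op (\<C> (under_arc_right D x)) (\<C> (over_arc D x))}"

definition shadow_colorings ::
  "'q set \<Rightarrow> ('q \<Rightarrow> 'q \<Rightarrow> 'q) \<Rightarrow> 'm set \<Rightarrow> ('m \<Rightarrow> 'q \<Rightarrow> 'm) \<Rightarrow> diagram \<Rightarrow>
   (((nat \<times> real) set \<Rightarrow> 'q) \<times> (complex set \<Rightarrow> 'm)) set" where
  "shadow_colorings Q op M act D =
     {(\<C>, \<S>). \<C> \<in> colorings Q op D \<and> \<S> \<in> regions D \<rightarrow>\<^sub>E M \<and>
        (\<forall>q\<in>params D. regular D q \<and> pt D q \<notin> crossings D \<longrightarrow>
           \<S> (left_region D q) = act (\<S> (right_region D q)) (\<C> (arc_of D q)))}"

definition twisted_weight ::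
  "('r, 'k) ring_scheme \<Rightarrow> ('r, 'a, 'l) module_scheme \<Rightarrow> ('q \<Rightarrow> 'q \<Rightarrow> 'a) \<Rightarrow> diagram \<Rightarrow>
   ((nat \<times> real) set \<Rightarrow> 'q) \<Rightarrow> 'r \<Rightarrow> 'a" where
  "twisted_weight R A \<omega> D \<C> \<alpha> =
     (\<Oplus>\<^bsub>A\<^esub>x\<in>crossings D.
        [crossing_sign D x] \<cdot>\<^bsub>A\<^esub>
          ((\<alpha> [^]\<^bsub>R\<^esub> (- crossing_index D x)) \<odot>\<^bsub>A\<^esub>
             \<omega> (\<C> (under_arc_right D x)) (\<C> (over_arc D x))))"

definition shadow_weight ::
  "('r, 'a, 'l) module_scheme \<Rightarrow> ('m \<Rightarrow> 'q \<Rightarrow> 'q \<Rightarrow> 'a) \<Rightarrow> diagram \<Rightarrow>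
   ((nat \<times> real) set \<Rightarrow> 'q) \<times> (complex set \<Rightarrow> 'm) \<Rightarrow> 'a" where
  "shadow_weight A \<phi> D = (\<lambda>(\<C>, \<S>).
     (\<Oplus>\<^bsub>A\<^esub>x\<in>crossings D.
        [crossing_sign D x] \<cdot>\<^bsub>A\<^esub>
          \<phi> (\<S> (source_region D x)) (\<C> (under_arc_right D x)) (\<C> (over_arc D x))))"

definition multisets_coincide :: "'i set \<Rightarrow> ('i \<Rightarrow> 'a) \<Rightarrow> 'j set \<Rightarrow> ('j \<Rightarrow> 'a) \<Rightarrow> bool" where
  "multisets_coincide I f J g \<longleftrightarrow> (\<exists>h. bij_betw h I J \<and> (\<forall>x\<in>I. f x = g (h x)))"

end

(*
  Colouring the regions of D by integers so that crossing a strand from right to left adds one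
  leaves no choice: along a transverse path the colour drops by the algebraic intersection number,
  and every region is joined to the exterior one by a transverse path (a horizontal one, at a
  height that Sard's theorem makes generic).  Hence the only such colouring that vanishes on the
  exterior region is the index, provided one exists at all.  It does: the sum of the winding
  numbers of the components about a region jumps by one across each strand.  This also shows that
  the index does not depend on the path.  So a colouring of the arcs has exactly one shadow
  extension, and the two weights agree term by term.
*)

theory Submission
  imports Defs "HOL-Complex_Analysis.Riemann_Mapping" "HOL-Library.Periodic_Fun"
begin


text \<open>The obstacle is local. The regions beside a strand are described by the germ of a single
  ray along the normal, whereas a transverse path reaches the strand along a curve that is only
  tangent to its limiting direction. What is proved is therefore uniform in the direction: if every
  direction in a compact set \<open>K\<close> is transverse to all strands through \<open>z\<close>,
  then the sets \<open>z + \<epsilon> K\<close> miss the whole diagram for all small \<epsilon>. For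
  convex \<open>K\<close> they then lie in one region. This fact identifies the regions beside a
  strand, the source region of a crossing, and the regions that a path leaves and enters. The
  components need not be rectifiable near a corner, so their winding numbers are not computed as
  integrals. They are handled through continuous logarithms, and the jump across a strand is read
  off from the derivative at the one point that is crossed.\<close>

section \<open>Finite sums in a module\<close>

text \<open>The relation evaluates \<open>f\<close> at elements of \<open>S\<close> only. Since
  \<open>finsum\<close> is a description over this relation, equal relations give equal sums
  whatever the summands are; two weights can then be compared termwise without asking where the
  colors at a crossing lie.\<close>

lemma foldSetD_cong:
  assumes "(S, y) \<in> foldSetD C (m \<circ> f) e" "\<forall>x\<in>S. f x = g x"
  shows "(S, y) \<in> foldSetD C (m \<circ> g) e"
  using assms
proof (induction rule: foldSetD.induct)
  case (insertI x A y)
  then have "(insert x A, (m \<circ> g) x y) \<in> foldSetD C (m \<circ> g) e"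
    by (intro foldSetD.insertI) auto
  moreover have "(m \<circ> g) x y = (m \<circ> f) x y"
    using insertI.prems by simp
  ultimately show ?case by metis
qed (rule foldSetD.emptyI)

text \<open>Unlike in the library's congruence rule, the summands need not lie in the carrier.\<close>

lemma finsum_cong_on:
  assumes "\<And>x. x \<in> S \<Longrightarrow> f x = g x"
  shows "finsum G f S = finsum G g S"
proof -
  let ?M = "add_monoid G"
  have "(S, y) \<in> foldSetD (carrier ?M) (mult ?M \<circ> f) \<one>\<^bsub>?M\<^esub> \<longleftrightarrow>
        (S, y) \<in> foldSetD (carrier ?M) (mult ?M \<circ> g) \<one>\<^bsub>?M\<^esub>" for y
    using foldSetD_cong[of S y _ "mult ?M" f _ g] foldSetD_cong[of S y _ "mult ?M" g _ f] assms
    by metis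
  then show ?thesis
    unfolding finsum_def finprod_def foldD_def by presburger
qed

section \<open>The determinant of two plane vectors and its half-planes\<close>

lemma cross2_add_right: "cross2 u (v + w) = cross2 u v + cross2 u w"
  and cross2_diff_right: "cross2 u (v - w) = cross2 u v - cross2 u w"
  and cross2_minus_right: "cross2 u (- v) = - cross2 u v"
  and cross2_scaleR_right: "cross2 u (r *\<^sub>R v) = r * cross2 u v"
  and cross2_of_real_mult_right: "cross2 u (of_real r * v) = r * cross2 u v"
  and cross2_self: "cross2 u u = 0"
  and cross2_commute: "cross2 u v = - cross2 v u"
  by (simp_all add: cross2_def algebra_simps)

lemma cross2_i: "cross2 u (\<i> * u) = (cmod u)\<^sup>2"
  unfolding cmod_power2 by (simp add: cross2_def power2_eq_square)

lemma linear_cross2: "linear (cross2 u)"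
  by (rule linearI) (simp_all add: cross2_add_right cross2_scaleR_right)

lemma abs_cross2_le: "\<bar>cross2 u v\<bar> \<le> cmod u * cmod v"
proof -
  have "cross2 u v = Im (cnj u * v)" by (simp add: cross2_def)
  then show ?thesis
    by (metis abs_Im_le_cmod complex_mod_cnj norm_mult)
qed

lemma continuous_on_cross2 [continuous_intros]:
  "continuous_on S f \<Longrightarrow> continuous_on S (\<lambda>x. cross2 u (f x))"
  unfolding cross2_def by (intro continuous_intros)

lemma convex_cross2_pos: "convex {w. 0 < cross2 u w}"
  and convex_cross2_neg: "convex {w. cross2 u w < 0}"
proof -
  have "{w. 0 < cross2 u w} = cross2 u -` {0<..}" "{w. cross2 u w < 0} = cross2 u -` {..<0}" by auto
  then show "convex {w. 0 < cross2 u w}" "convex {w. cross2 u w < 0}"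
    by (simp_all add: convex_linear_vimage[OF linear_cross2])
qed

lemma eventually_at_right_0_I:
  "(0::real) < d \<Longrightarrow> (\<And>e. 0 < e \<Longrightarrow> e < d \<Longrightarrow> P e) \<Longrightarrow> eventually P (at_right 0)"
  by (auto simp: eventually_at_right_field)

section \<open>Periodic curves, the compact image of a diagram, and its regions\<close>

locale planar_diagram =
  fixes D :: diagram
  assumes kd: "knot_diagram D"
begin

lemma cont_curve: "i < ncomp D \<Longrightarrow> continuous_on UNIV (curve D i)"
  and curve_plus_1: "i < ncomp D \<Longrightarrow> curve D i (t + 1) = curve D i t"
  and finite_nonregular: "finite {q \<in> params D. \<not> regular D q}"
  and finite_crossings: "finite (crossings D)"
  and card_crossing: "x \<in> crossings D \<Longrightarrow> card {q \<in> params D. pt D q = x} = 2"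
  and double_point: "q \<in> params D \<Longrightarrow> q' \<in> params D \<Longrightarrow> q \<noteq> q' \<Longrightarrow> pt D q = pt D q' \<Longrightarrow>
        regular D q \<and> regular D q' \<and> cross2 (vel D q) (vel D q') \<noteq> 0 \<and>
        (q \<in> under D \<longleftrightarrow> q' \<notin> under D)"
  using kd unfolding knot_diagram_def by blast+

lemma curve_plus_int: "i < ncomp D \<Longrightarrow> curve D i (t + of_int k) = curve D i t"
proof -
  assume "i < ncomp D"
  then interpret periodic_fun_simple' "curve D i" by unfold_locales (rule curve_plus_1)
  show ?thesis by (rule plus_of_int)
qed

lemma curve_frac: "i < ncomp D \<Longrightarrow> curve D i (frac t) = curve D i t"
  using curve_plus_int[of i "frac t" "\<lfloor>t\<rfloor>"] by (simp add: frac_def)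

lemma params_frac: "i < ncomp D \<Longrightarrow> (i, frac t) \<in> params D"
  by (simp add: params_def frac_lt_1)

lemma pt_frac: "i < ncomp D \<Longrightarrow> pt D (i, frac t) = curve D i t"
  by (simp add: pt_def curve_frac)

lemma regular_vel_nz: "regular D q \<Longrightarrow> vel D q \<noteq> 0"
  by (simp add: regular_def)

lemma regular_deriv:
  assumes "regular D q"
  shows "(curve D (fst q) has_vector_derivative vel D q) (at (snd q))"
proof -
  from assms obtain d where "d > 0" "curve D (fst q) C1_differentiable_on {snd q - d<..<snd q + d}"
    by (auto simp: regular_def)
  then have "curve D (fst q) differentiable (at (snd q))"
    by (auto simp: C1_differentiable_on_eq)
  then show ?thesis by (simp add: vel_def vector_derivative_works)
qed

text \<open>\<open>vel\<close> is attached to parameters in [0,1). Translation by the integer part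
  of \<open>t\<close> carries the derivative to all real times, which is needed where a neighborhood
  of a parameter wraps around the period.\<close>

lemma curve_deriv:
  assumes "i < ncomp D" "regular D (i, frac t)"
  shows "(curve D i has_vector_derivative vel D (i, frac t)) (at t)"
proof -
  have "(curve D i has_vector_derivative vel D (i, frac t)) (at (frac t))"
    using regular_deriv[OF assms(2)] by simp
  then have "((\<lambda>s. curve D i (s - of_int \<lfloor>t\<rfloor>)) has_vector_derivative vel D (i, frac t)) (at t)"
    by (intro vector_diff_chain_at[of "\<lambda>s. s - of_int \<lfloor>t\<rfloor>" 1 t "curve D i", simplified o_def, simplified])
       (auto intro!: derivative_eq_intros simp: frac_def)
  moreover have "curve D i (s - of_int \<lfloor>t\<rfloor>) = curve D i s" for s
    using curve_plus_int[OF assms(1), of s "- \<lfloor>t\<rfloor>"] by simp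
  ultimately show ?thesis by simp
qed

text \<open>By periodicity the closed period adds no point to the half-open one; it exhibits the
  image as a finite union of compact sets.\<close>

lemma diagram_image_eq: "diagram_image D = (\<Union>i<ncomp D. curve D i ` {0..1})"
proof -
  have "curve D i t \<in> diagram_image D" if "i < ncomp D" for i t
    using pt_frac[OF that, of t] params_frac[OF that, of t] unfolding diagram_image_def
    by (metis imageI)
  moreover have "pt D q \<in> (\<Union>i<ncomp D. curve D i ` {0..1})" if "q \<in> params D" for q
    using that by (force simp: params_def pt_def)
  ultimately show ?thesis unfolding diagram_image_def by fastforce
qed

lemma curve_in_image: "i < ncomp D \<Longrightarrow> curve D i t \<in> diagram_image D"
  unfolding diagram_image_def using pt_frac[of i t] params_frac[of i t] by (metis imageI)

lemma compact_image: "compact (diagram_image D)"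
  unfolding diagram_image_eq
  by (intro compact_UN ballI compact_continuous_image continuous_on_subset[OF cont_curve]) auto

lemma open_compl_image: "open (- diagram_image D)"
  using compact_image by (simp add: compact_imp_closed open_Compl)

lemma region_open: "\<Delta> \<in> regions D \<Longrightarrow> open \<Delta>"
  unfolding regions_def using open_compl_image open_components by blast

lemma region_connected: "\<Delta> \<in> regions D \<Longrightarrow> connected \<Delta>"
  unfolding regions_def by (rule in_components_connected)

lemma region_nonempty: "\<Delta> \<in> regions D \<Longrightarrow> \<Delta> \<noteq> {}"
  unfolding regions_def by (rule in_components_nonempty)

lemma region_subset: "\<Delta> \<in> regions D \<Longrightarrow> \<Delta> \<subseteq> - diagram_image D"
  unfolding regions_def by (rule in_components_subset)

lemma region_unique: "\<Delta> \<in> regions D \<Longrightarrow> \<Delta>' \<in> regions D \<Longrightarrow> z \<in> \<Delta> \<Longrightarrow> z \<in> \<Delta>' \<Longrightarrow> \<Delta> = \<Delta>'"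
  unfolding regions_def using components_nonoverlap by blast

lemma connected_in_region:
  assumes "connected T" "T \<noteq> {}" "T \<inter> diagram_image D = {}"
  shows "\<exists>\<Delta>\<in>regions D. T \<subseteq> \<Delta>"
  using assms exists_component_superset[of T "- diagram_image D"] unfolding regions_def by auto

text \<open>The complement of a bounded set in the plane has exactly one unbounded component, so the
  description in \<open>exterior_region\<close> denotes.\<close>

lemma exterior:
  shows exterior_in_regions: "exterior_region D \<in> regions D"
    and exterior_unique: "\<Delta> \<in> regions D \<Longrightarrow> \<not> bounded \<Delta> \<Longrightarrow> \<Delta> = exterior_region D"
proof -
  have b: "bounded (- (- diagram_image D))" using compact_image by (simp add: compact_imp_bounded)
  have "\<exists>!\<Delta>. \<Delta> \<in> regions D \<and> \<not> bounded \<Delta>"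
    using cobounded_unbounded_components[OF b] cobounded_unique_unbounded_components[OF b]
    unfolding regions_def by (metis DIM_complex order_refl)
  from theI'[OF this] this show "exterior_region D \<in> regions D"
    "\<Delta> \<in> regions D \<Longrightarrow> \<not> bounded \<Delta> \<Longrightarrow> \<Delta> = exterior_region D"
    unfolding exterior_region_def by auto
qed

lemma far_in_exterior: "\<exists>B>0. \<forall>z. cmod z > B \<longrightarrow> z \<in> exterior_region D"
proof -
  obtain B where B: "B > 0" "diagram_image D \<subseteq> cball 0 B"
    using compact_imp_bounded[OF compact_image] bounded_subset_ballD ball_subset_cball by (meson order_trans)
  have con: "connected (- cball (0::complex) B)"
    by (intro connected_complement_bounded_convex) auto
  have unb: "\<not> bounded (- cball (0::complex) B)"
    by (metis bounded_cball cobounded_imp_unbounded)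
  then have "- cball (0::complex) B \<noteq> {}" by (metis bounded_empty)
  with con B connected_in_region[of "- cball 0 B"] obtain \<Delta> where
    "\<Delta> \<in> regions D" "- cball 0 B \<subseteq> \<Delta>" by blast
  with unb exterior_unique have "- cball 0 B \<subseteq> exterior_region D"
    by (metis bounded_subset)
  then show ?thesis using B(1) by (intro exI[of _ B]) (auto simp: subset_iff)
qed


section \<open>Cones at a point of the diagram\<close>

text \<open>A strand that is not at \<open>z\<close> at time \<open>s\<close> keeps a positive
  distance from \<open>z\<close> nearby, while the cone shrinks to \<open>z\<close>. A strand
  through \<open>z\<close> is its tangent plus a small remainder; the determinant with the tangent
  \<open>v\<close> kills the tangential part, and the remainder is too small to account for the
  determinant of a direction in \<open>K\<close>. The time radius \<open>d\<close> does not depend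
  on \<epsilon>, which the covering argument for the whole period requires.\<close>

lemma strand_avoids_cone_locally:
  assumes i: "i < ncomp D" and K: "compact K"
    and reg: "curve D i s = z \<Longrightarrow> regular D (i, frac s)"
    and trans: "\<And>k. curve D i s = z \<Longrightarrow> k \<in> K \<Longrightarrow> cross2 (vel D (i, frac s)) k \<noteq> 0"
  shows "\<exists>d>0. \<forall>\<^sub>F \<epsilon> in at_right 0. \<forall>s'. \<bar>s' - s\<bar> < d \<longrightarrow>
           (\<forall>k\<in>K. curve D i s' \<noteq> z + of_real \<epsilon> * k)"
proof -
  let ?c = "curve D i"
  obtain B where B: "B > 0" "\<And>k. k \<in> K \<Longrightarrow> cmod k \<le> B"
    using compact_imp_bounded[OF K] unfolding bounded_pos by blast
  show ?thesis
  proof (cases "?c s = z")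
    case False
    define r where "r = cmod (?c s - z)"
    have r: "r > 0" using False by (simp add: r_def)
    have "isCont ?c s" using cont_curve[OF i] by (simp add: continuous_on_eq_continuous_at)
    then obtain d where d: "d > 0" "\<And>s'. \<bar>s' - s\<bar> < d \<Longrightarrow> cmod (?c s' - ?c s) < r / 2"
      using r unfolding continuous_at_eps_delta dist_norm real_norm_def by (meson half_gt_zero)
    have "\<forall>\<^sub>F \<epsilon> in at_right 0. \<forall>s'. \<bar>s' - s\<bar> < d \<longrightarrow> (\<forall>k\<in>K. ?c s' \<noteq> z + of_real \<epsilon> * k)"
    proof (rule eventually_at_right_0_I)
      show "0 < r / (2 * B)" using r B by simp
    next
      have False if e: "0 < \<epsilon>" "\<epsilon> < r / (2 * B)" and s': "\<bar>s' - s\<bar> < d"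
        and k: "k \<in> K" and eq: "?c s' = z + of_real \<epsilon> * k" for \<epsilon> s' k
      proof -
        have "cmod (?c s' - z) = \<epsilon> * cmod k" using e eq by (simp add: norm_mult)
        also have "\<dots> \<le> \<epsilon> * B" using e B k by simp
        also have "\<dots> < r / 2" using e B by (simp add: field_simps)
        finally have "cmod (?c s' - z) < r / 2" .
        moreover have "r \<le> cmod (?c s' - ?c s) + cmod (?c s' - z)"
          unfolding r_def using norm_triangle_ineq4[of "?c s' - z" "?c s' - ?c s"] by simp
        ultimately show False using d(2)[OF s'] by linarith
      qed
      then show "\<forall>s'. \<bar>s' - s\<bar> < d \<longrightarrow> (\<forall>k\<in>K. ?c s' \<noteq> z + of_real \<epsilon> * k)"
        if "0 < \<epsilon>" "\<epsilon> < r / (2 * B)" for \<epsilon> using that by blast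
    qed
    with d show ?thesis by blast
  next
    case True
    define v where "v = vel D (i, frac s)"
    have v: "v \<noteq> 0" using regular_vel_nz reg[OF True] by (simp add: v_def)
    \<comment> \<open>Compactness of \<open>K\<close> turns transversality into a uniform bound; for
      empty \<open>K\<close> any positive number serves.\<close>
    have "\<exists>m>0. \<forall>k\<in>K. m \<le> \<bar>cross2 v k\<bar>"
    proof (cases "K = {}")
      case False
      have "continuous_on K (\<lambda>k. \<bar>cross2 v k\<bar>)" by (intro continuous_intros)
      from continuous_attains_inf[OF K False this] obtain k0 where
        "k0 \<in> K" "\<forall>k\<in>K. \<bar>cross2 v k0\<bar> \<le> \<bar>cross2 v k\<bar>" by blast
      then show ?thesis using trans[OF True, of k0] by (intro exI[of _ "\<bar>cross2 v k0\<bar>"]) (simp add: v_def)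
    qed (auto intro: exI[of _ 1])
    then obtain m where m: "m > 0" "\<And>k. k \<in> K \<Longrightarrow> m \<le> \<bar>cross2 v k\<bar>" by blast
    \<comment> \<open>The first bound lets half of \<open>\<bar>h\<bar> * cmod v\<close> absorb the
      remainder, so that \<open>\<bar>h\<bar> * cmod v \<le> 2 * \<epsilon> * B\<close>. The second
      then leaves a determinant of at most \<open>m / 2\<close>, against the lower bound
      \<open>m\<close>.\<close>
    define \<eta> where "\<eta> = min (cmod v / 2) (m / (4 * B))"
    have \<eta>: "\<eta> > 0" "\<eta> \<le> cmod v / 2" "\<eta> \<le> m / (4 * B)" using v m B by (auto simp: \<eta>_def)
    have "(?c has_derivative (\<lambda>h. h *\<^sub>R v)) (at s)"
      using curve_deriv[OF i reg[OF True]] by (simp add: v_def has_vector_derivative_def)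
    then obtain d where d: "d > 0"
      "\<And>s'. \<bar>s' - s\<bar> < d \<Longrightarrow> cmod (?c s' - ?c s - (s' - s) *\<^sub>R v) \<le> \<eta> * \<bar>s' - s\<bar>"
      using \<eta>(1) unfolding has_derivative_at_alt real_norm_def by blast
    have "?c s' \<noteq> z + of_real \<epsilon> * k" if e: "0 < \<epsilon>" and s': "\<bar>s' - s\<bar> < d" and k: "k \<in> K" for \<epsilon> s' k
    proof
      assume eq: "?c s' = z + of_real \<epsilon> * k"
      define h where "h = s' - s"
      define R where "R = ?c s' - ?c s - h *\<^sub>R v"
      have R: "cmod R \<le> \<eta> * \<bar>h\<bar>" using d(2)[OF s'] by (simp add: R_def h_def)
      have ek: "of_real \<epsilon> * k = R + h *\<^sub>R v" using eq True by (simp add: R_def)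
      have "cmod (h *\<^sub>R v) \<le> cmod (of_real \<epsilon> * k) + cmod R"
        using norm_triangle_ineq4[of "of_real \<epsilon> * k" R] ek by simp
      then have "\<bar>h\<bar> * cmod v \<le> \<epsilon> * cmod k + \<eta> * \<bar>h\<bar>" using R e by (simp add: norm_mult)
      moreover have "\<epsilon> * cmod k \<le> \<epsilon> * B" using B k e by simp
      moreover have "\<eta> * \<bar>h\<bar> \<le> cmod v / 2 * \<bar>h\<bar>" using \<eta>(2) by (intro mult_right_mono) auto
      ultimately have hv: "\<bar>h\<bar> * cmod v \<le> 2 * \<epsilon> * B" by (simp add: algebra_simps)
      have "\<epsilon> * \<bar>cross2 v k\<bar> = \<bar>cross2 v (of_real \<epsilon> * k)\<bar>" using e by (simp add: cross2_of_real_mult_right abs_mult)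
      also have "\<dots> = \<bar>cross2 v R\<bar>" by (simp add: ek cross2_add_right cross2_scaleR_right cross2_self)
      also have "\<dots> \<le> cmod v * cmod R" by (rule abs_cross2_le)
      also have "\<dots> \<le> cmod v * (\<eta> * \<bar>h\<bar>)" using R by (intro mult_left_mono) auto
      also have "\<dots> = \<eta> * (\<bar>h\<bar> * cmod v)" by simp
      also have "\<dots> \<le> \<eta> * (2 * \<epsilon> * B)" using hv \<eta>(1) by (intro mult_left_mono) auto
      also have "\<dots> \<le> m / (4 * B) * (2 * \<epsilon> * B)" using \<eta>(3) e B by (intro mult_right_mono) auto
      also have "\<dots> = \<epsilon> * (m / 2)" using B by (simp add: field_simps)
      finally have "\<bar>cross2 v k\<bar> \<le> m / 2" using e by simp
      with m(2)[OF k] m(1) show False by simp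
    qed
    then have "\<forall>\<^sub>F \<epsilon> in at_right 0. \<forall>s'. \<bar>s' - s\<bar> < d \<longrightarrow> (\<forall>k\<in>K. ?c s' \<noteq> z + of_real \<epsilon> * k)"
      by (intro eventually_at_right_0_I[of 1]) auto
    with d(1) show ?thesis by blast
  qed
qed

text \<open>The local thresholds for \<epsilon> combine to a global one by compactness of a period,
  here in the form of bisection: avoidance on two adjacent intervals gives avoidance on their union.
  There are finitely many components.\<close>

lemma diagram_avoids_cone:
  assumes K: "compact K"
    and trans: "\<And>q k. q \<in> params D \<Longrightarrow> pt D q = z \<Longrightarrow> k \<in> K \<Longrightarrow> regular D q \<and> cross2 (vel D q) k \<noteq> 0"
  shows "\<forall>\<^sub>F \<epsilon> in at_right 0. \<forall>k\<in>K. z + of_real \<epsilon> * k \<notin> diagram_image D"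
proof (cases "K = {}")
  case False
  then obtain k0 where k0: "k0 \<in> K" by blast
  have one: "\<forall>\<^sub>F \<epsilon> in at_right 0. \<forall>s\<in>{0..1}. \<forall>k\<in>K. curve D i s \<noteq> z + of_real \<epsilon> * k"
    if i: "i < ncomp D" for i
  proof (rule Bolzano[where P = "\<lambda>a b. \<forall>\<^sub>F \<epsilon> in at_right 0. \<forall>s\<in>{a..b}. \<forall>k\<in>K.
      curve D i s \<noteq> z + of_real \<epsilon> * k", OF zero_le_one])
    let ?P = "\<lambda>a b. \<forall>\<^sub>F \<epsilon> in at_right 0. \<forall>s\<in>{a..b}. \<forall>k\<in>K. curve D i s \<noteq> z + of_real \<epsilon> * k"
    fix a b c :: real assume "?P a b" "?P b c"
    then show "?P a c"
    proof eventually_elim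
      case (elim \<epsilon>)
      have "s \<in> {a..b} \<or> s \<in> {b..c}" if "s \<in> {a..c}" for s using that by auto
      with elim show ?case by blast
    qed
  next
    fix s :: real
    have q: "(i, frac s) \<in> params D" "pt D (i, frac s) = curve D i s"
      using i by (simp_all add: params_frac pt_frac)
    obtain d where d: "d > 0" "\<forall>\<^sub>F \<epsilon> in at_right 0. \<forall>s'. \<bar>s' - s\<bar> < d \<longrightarrow>
           (\<forall>k\<in>K. curve D i s' \<noteq> z + of_real \<epsilon> * k)"
      using strand_avoids_cone_locally[OF i K, of s z] trans[of "(i, frac s)"] q k0 by auto
    show "\<exists>d>0. \<forall>a b. a \<le> s \<and> s \<le> b \<and> b - a < d \<longrightarrow> (\<forall>\<^sub>F \<epsilon> in at_right 0.
        \<forall>s\<in>{a..b}. \<forall>k\<in>K. curve D i s \<noteq> z + of_real \<epsilon> * k)"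
    proof (intro exI[of _ d] conjI allI impI)
      fix a b assume ab: "a \<le> s \<and> s \<le> b \<and> b - a < d"
      from d(2) show "\<forall>\<^sub>F \<epsilon> in at_right 0. \<forall>s\<in>{a..b}. \<forall>k\<in>K. curve D i s \<noteq> z + of_real \<epsilon> * k"
      proof eventually_elim
        case (elim \<epsilon>)
        moreover have "\<bar>s' - s\<bar> < d" if "s' \<in> {a..b}" for s' using that ab by (auto simp: abs_if)
        ultimately show ?case by blast
      qed
    qed (rule d)
  qed
  have "\<forall>\<^sub>F \<epsilon> in at_right 0. \<forall>i\<in>{..<ncomp D}. \<forall>s\<in>{0..1}. \<forall>k\<in>K. curve D i s \<noteq> z + of_real \<epsilon> * k"
    using one by (intro eventually_ball_finite) auto
  then show ?thesis
    unfolding diagram_image_eq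
  proof eventually_elim
    case (elim \<epsilon>)
    show ?case
    proof (intro ballI notI)
      fix k assume "k \<in> K" "z + of_real \<epsilon> * k \<in> (\<Union>i<ncomp D. curve D i ` {0..1})"
      then obtain i s where "i \<in> {..<ncomp D}" "s \<in> {0..1}" "z + of_real \<epsilon> * k = curve D i s" by blast
      with elim \<open>k \<in> K\<close> show False by metis
    qed
  qed
qed auto

text \<open>The punctured, truncated cone is the continuous image of an interval times a convex set,
  hence connected. A single \<epsilon>-threshold serves all of \<open>K\<close>, so the direction
  may vary with \<epsilon>.\<close>

lemma cone_in_region:
  assumes K: "compact K" "convex K" "K \<noteq> {}"
    and trans: "\<And>q k. q \<in> params D \<Longrightarrow> pt D q = z \<Longrightarrow> k \<in> K \<Longrightarrow> regular D q \<and> cross2 (vel D q) k \<noteq> 0"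
  shows "\<exists>\<Delta>\<in>regions D. \<forall>\<^sub>F \<epsilon> in at_right 0. \<forall>k\<in>K. z + of_real \<epsilon> * k \<in> \<Delta>"
proof -
  obtain \<delta> where \<delta>: "\<delta> > 0" "\<And>\<epsilon> k. 0 < \<epsilon> \<Longrightarrow> \<epsilon> < \<delta> \<Longrightarrow> k \<in> K \<Longrightarrow> z + of_real \<epsilon> * k \<notin> diagram_image D"
    using diagram_avoids_cone[where z = z, OF K(1) trans] unfolding eventually_at_right_field by blast
  define T where "T = (\<lambda>(\<epsilon>, k). z + complex_of_real \<epsilon> * k) ` ({0<..<\<delta>} \<times> K)"
  have "connected T" unfolding T_def case_prod_beta
    by (intro connected_continuous_image connected_Times continuous_intros convex_connected K) auto
  moreover have "T \<noteq> {}" using \<delta> K(3) by (auto simp: T_def)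
  moreover have "T \<inter> diagram_image D = {}" using \<delta> by (auto simp: T_def)
  ultimately obtain \<Delta> where \<Delta>: "\<Delta> \<in> regions D" "T \<subseteq> \<Delta>" using connected_in_region by blast
  have "z + of_real \<epsilon> * k \<in> \<Delta>" if "0 < \<epsilon>" "\<epsilon> < \<delta>" "k \<in> K" for \<epsilon> k
    using \<Delta>(2) that by (force simp: T_def)
  then show ?thesis using \<Delta>(1) \<delta>(1) by (intro bexI[of _ \<Delta>] eventually_at_right_0_I[of \<delta>]) auto
qed

text \<open>Distinct regions are disjoint, so a germ determines its region. This settles uniqueness
  in the descriptions of regions by rays.\<close>

lemma eventually_region_unique:
  assumes "\<Delta> \<in> regions D" "\<Delta>' \<in> regions D"
    "\<forall>\<^sub>F \<epsilon> in at_right (0::real). f \<epsilon> \<in> \<Delta>" "\<forall>\<^sub>F \<epsilon> in at_right 0. f \<epsilon> \<in> \<Delta>'"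
  shows "\<Delta> = \<Delta>'"
proof -
  have "\<forall>\<^sub>F \<epsilon> in at_right (0::real). f \<epsilon> \<in> \<Delta> \<and> f \<epsilon> \<in> \<Delta>'" using assms(3,4) by (rule eventually_conj)
  then obtain \<epsilon> where "f \<epsilon> \<in> \<Delta>" "f \<epsilon> \<in> \<Delta>'"
    using eventually_happens'[OF trivial_limit_at_right_real] by blast
  then show ?thesis using assms region_unique by blast
qed

lemma region_towards_eq:
  assumes "\<Delta> \<in> regions D" "\<forall>\<^sub>F \<epsilon> in at_right 0. z + of_real \<epsilon> * w \<in> \<Delta>"
  shows "region_towards D z w = \<Delta>"
  unfolding region_towards_def
  by (rule the_equality) (use assms eventually_region_unique[where f = "\<lambda>\<epsilon>. z + of_real \<epsilon> * w"] in blast)+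

section \<open>The two sides of a strand away from the crossings\<close>

lemma noncrossing_param_unique:
  "q \<in> params D \<Longrightarrow> pt D q \<notin> crossings D \<Longrightarrow> q' \<in> params D \<Longrightarrow> pt D q' = pt D q \<Longrightarrow> q' = q"
  unfolding crossings_def by blast

lemma param_of_eq: "q \<in> params D \<Longrightarrow> pt D q \<notin> crossings D \<Longrightarrow> param_of D (pt D q) = q"
  unfolding param_of_def using noncrossing_param_unique by blast

text \<open>The factor \<sigma> treats both sides at once: 1 gives the left side and -1 the right
  side.\<close>

lemma half_plane_cone:
  assumes q: "q \<in> params D" "regular D q" "pt D q \<notin> crossings D"
    and K: "compact K" and \<sigma>: "\<sigma> \<noteq> 0"
    and pos: "\<And>k. k \<in> K \<Longrightarrow> 0 < cross2 (of_real \<sigma> * vel D q) k"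
  defines "\<Delta> \<equiv> region_towards D (pt D q) (\<i> * (of_real \<sigma> * vel D q))"
  shows "\<Delta> \<in> regions D" "\<forall>\<^sub>F \<epsilon> in at_right 0. \<forall>k\<in>K. pt D q + of_real \<epsilon> * k \<in> \<Delta>"
proof -
  define v where "v = of_real \<sigma> * vel D q"
  have v: "v \<noteq> 0" using regular_vel_nz[OF q(2)] \<sigma> by (simp add: v_def)
  \<comment> \<open>Adding the normal ties the cone to the ray that defines \<Delta>. The hull stays
    in the open half-plane because that is convex, and it stays compact.\<close>
  define H where "H = convex hull (insert (\<i> * v) K)"
  have H: "compact H" "convex H" "insert (\<i> * v) K \<subseteq> H"
    unfolding H_def using K by (simp_all add: compact_convex_hull compact_insert hull_subset del: insert_subset)
  have "H \<subseteq> {k. 0 < cross2 v k}"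
    unfolding H_def using pos v by (intro hull_minimal convex_cross2_pos) (auto simp: cross2_i v_def[symmetric])
  moreover have "cross2 v k = \<sigma> * cross2 (vel D q) k" for k
    by (simp add: v_def cross2_def algebra_simps)
  ultimately have "cross2 (vel D q) k \<noteq> 0" if "k \<in> H" for k using that by fastforce
  then have "regular D q' \<and> cross2 (vel D q') k \<noteq> 0"
    if "q' \<in> params D" "pt D q' = pt D q" "k \<in> H" for q' k
    using noncrossing_param_unique[OF q(1,3) that(1,2)] that(3) q(2) by simp
  then obtain \<Delta>' where \<Delta>': "\<Delta>' \<in> regions D" "\<forall>\<^sub>F \<epsilon> in at_right 0. \<forall>k\<in>H. pt D q + of_real \<epsilon> * k \<in> \<Delta>'"
    using cone_in_region[of H "pt D q"] H by auto
  have "\<forall>\<^sub>F \<epsilon> in at_right 0. pt D q + of_real \<epsilon> * (\<i> * v) \<in> \<Delta>'"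
    using \<Delta>'(2) by eventually_elim (use H in auto)
  then have "\<Delta> = \<Delta>'" unfolding \<Delta>_def v_def[symmetric] by (rule region_towards_eq[OF \<Delta>'(1)])
  then show "\<Delta> \<in> regions D" "\<forall>\<^sub>F \<epsilon> in at_right 0. \<forall>k\<in>K. pt D q + of_real \<epsilon> * k \<in> \<Delta>"
    using \<Delta>' H(3) by (auto elim!: eventually_mono)
qed

lemma left_cone:
  assumes "q \<in> params D" "regular D q" "pt D q \<notin> crossings D"
    and "compact K" "\<And>k. k \<in> K \<Longrightarrow> 0 < cross2 (vel D q) k"
  shows "\<forall>\<^sub>F \<epsilon> in at_right 0. \<forall>k\<in>K. pt D q + of_real \<epsilon> * k \<in> left_region D q"
  using half_plane_cone(2)[OF assms(1-4), of 1] assms(5) by (simp add: left_region_def)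

lemma right_cone:
  assumes "q \<in> params D" "regular D q" "pt D q \<notin> crossings D"
    and "compact K" "\<And>k. k \<in> K \<Longrightarrow> cross2 (vel D q) k < 0"
  shows "\<forall>\<^sub>F \<epsilon> in at_right 0. \<forall>k\<in>K. pt D q + of_real \<epsilon> * k \<in> right_region D q"
proof -
  have "cross2 (- vel D q) k = - cross2 (vel D q) k" for k by (simp add: cross2_def)
  then show ?thesis
    using half_plane_cone(2)[OF assms(1-4), of "-1"] assms(5) by (simp add: right_region_def)
qed

lemma left_region_in_regions:
    "q \<in> params D \<Longrightarrow> regular D q \<Longrightarrow> pt D q \<notin> crossings D \<Longrightarrow> left_region D q \<in> regions D"
  and right_region_in_regions:
    "q \<in> params D \<Longrightarrow> regular D q \<Longrightarrow> pt D q \<notin> crossings D \<Longrightarrow> right_region D q \<in> regions D"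
  using half_plane_cone(1)[of q "{}" 1] half_plane_cone(1)[of q "{}" "-1"]
  by (simp_all add: left_region_def right_region_def)

section \<open>Crossings and their source regions\<close>

lemma crossing_params:
  assumes "x \<in> crossings D"
  defines "a \<equiv> over_param D x" and "b \<equiv> under_param D x"
  shows "{q \<in> params D. pt D q = x} = {a, b}" "regular D a" "regular D b"
    "cross2 (vel D a) (vel D b) \<noteq> 0"
proof -
  obtain q q' where qq: "{q \<in> params D. pt D q = x} = {q, q'}" "q \<noteq> q'"
    using card_crossing[OF assms(1)] by (auto simp: card_2_iff)
  have q: "q \<in> params D" "q' \<in> params D" "pt D q = x" "pt D q' = x" using qq by blast+
  have dp: "regular D q" "regular D q'" "cross2 (vel D q) (vel D q') \<noteq> 0"
    "cross2 (vel D q') (vel D q) \<noteq> 0" "q \<in> under D \<longleftrightarrow> q' \<notin> under D"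
    using double_point[OF q(1,2) qq(2)] q(3,4) cross2_commute[of "vel D q'"] by auto
  have "\<exists>o1 u1. {q \<in> params D. pt D q = x} = {o1, u1} \<and> o1 \<notin> under D \<and> u1 \<in> under D \<and>
     regular D o1 \<and> regular D u1 \<and> cross2 (vel D o1) (vel D u1) \<noteq> 0"
  proof (cases "q \<in> under D")
    case True
    then show ?thesis using dp qq(1) 
      by (intro exI[of _ q'] exI[of _ q]) (simp add: insert_commute)
  next
    case False
    then show ?thesis using dp qq(1) by (intro exI[of _ q] exI[of _ q']) simp
  qed
  then obtain o1 u1 where ou: "{q \<in> params D. pt D q = x} = {o1, u1}" "o1 \<notin> under D" "u1 \<in> under D"
     "regular D o1" "regular D u1" "cross2 (vel D o1) (vel D u1) \<noteq> 0" by blast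
  have ch: "q \<in> params D \<and> pt D q = x \<longleftrightarrow> q = o1 \<or> q = u1" for q using ou(1) by blast
  have "a = o1" unfolding a_def over_param_def by (rule the_equality) (use ch ou in metis)+
  moreover have "b = u1" unfolding b_def under_param_def by (rule the_equality) (use ch ou in metis)+
  ultimately show "{q \<in> params D. pt D q = x} = {a, b}" "regular D a" "regular D b"
    "cross2 (vel D a) (vel D b) \<noteq> 0" using ou by simp_all
qed

text \<open>The directions to the right of both strands form a convex sector \<open>C\<close>. Two
  candidate directions are joined by a segment inside \<open>C\<close>, and the cone over this
  compact segment lies in one region, so the candidates name the same region.\<close>

lemma source_region_in_regions:
  assumes x: "x \<in> crossings D"
  shows "source_region D x \<in> regions D"
proof -
  define a b where "a = over_param D x" and "b = under_param D x"
  note P = crossing_params[OF x, folded a_def b_def]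
  define C where "C = {w. cross2 (vel D a) w < 0} \<inter> {w. cross2 (vel D b) w < 0}"
  have C: "convex C" unfolding C_def by (intro convex_Int convex_cross2_neg)
  have cone: "\<exists>\<Delta>\<in>regions D. \<forall>\<^sub>F \<epsilon> in at_right 0. \<forall>k\<in>K. x + of_real \<epsilon> * k \<in> \<Delta>"
    if "compact K" "convex K" "K \<noteq> {}" "K \<subseteq> C" for K
  proof (rule cone_in_region[OF that(1-3)])
    fix q k assume "q \<in> params D" "pt D q = x" "k \<in> K"
    moreover from this have "q = a \<or> q = b" using P(1) by blast
    ultimately show "regular D q \<and> cross2 (vel D q) k \<noteq> 0" using P(2,3) that(4) by (auto simp: C_def)
  qed
  define d where "d = cross2 (vel D a) (vel D b)"
  have d: "d \<noteq> 0" using P(4) by (simp add: d_def)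
  \<comment> \<open>Solution of the two linear equations that both determinants with
    \<open>w\<close> equal -1; division by \<open>d\<close> makes it independent of the sign of the
    crossing.\<close>
  define w where "w = (1 / d) *\<^sub>R vel D a - (1 / d) *\<^sub>R vel D b"
  have "cross2 (vel D a) w = -1"
    using d by (simp add: w_def cross2_diff_right cross2_scaleR_right cross2_self d_def[symmetric])
  moreover have "cross2 (vel D b) w = -1"
    using d by (simp add: w_def cross2_diff_right cross2_scaleR_right cross2_self
        cross2_commute[of "vel D b"] d_def[symmetric])
  ultimately have w: "w \<in> C" by (simp add: C_def)
  have "\<exists>!\<Delta>. \<Delta> \<in> regions D \<and> (\<exists>w. w \<in> C \<and> (\<forall>\<^sub>F \<epsilon> in at_right 0. x + of_real \<epsilon> * w \<in> \<Delta>))"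
  proof (rule ex_ex1I)
    show "\<exists>\<Delta>. \<Delta> \<in> regions D \<and> (\<exists>w. w \<in> C \<and> (\<forall>\<^sub>F \<epsilon> in at_right 0. x + of_real \<epsilon> * w \<in> \<Delta>))"
      using cone[of "{w}"] w by auto
  next
    fix \<Delta> \<Delta>'
    assume "\<Delta> \<in> regions D \<and> (\<exists>w. w \<in> C \<and> (\<forall>\<^sub>F \<epsilon> in at_right 0. x + of_real \<epsilon> * w \<in> \<Delta>))"
      "\<Delta>' \<in> regions D \<and> (\<exists>w. w \<in> C \<and> (\<forall>\<^sub>F \<epsilon> in at_right 0. x + of_real \<epsilon> * w \<in> \<Delta>'))"
    then obtain w1 w2 where w1: "\<Delta> \<in> regions D" "w1 \<in> C" "\<forall>\<^sub>F \<epsilon> in at_right 0. x + of_real \<epsilon> * w1 \<in> \<Delta>"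
      and w2: "\<Delta>' \<in> regions D" "w2 \<in> C" "\<forall>\<^sub>F \<epsilon> in at_right 0. x + of_real \<epsilon> * w2 \<in> \<Delta>'" by blast
    have "closed_segment w1 w2 \<subseteq> C" using C w1 w2 by (simp add: closed_segment_subset)
    then obtain \<Delta>'' where c: "\<Delta>'' \<in> regions D"
      "\<forall>\<^sub>F \<epsilon> in at_right 0. \<forall>k\<in>closed_segment w1 w2. x + of_real \<epsilon> * k \<in> \<Delta>''"
      using cone[of "closed_segment w1 w2"] by auto
    have "\<forall>\<^sub>F \<epsilon> in at_right 0. x + of_real \<epsilon> * w1 \<in> \<Delta>''" "\<forall>\<^sub>F \<epsilon> in at_right 0. x + of_real \<epsilon> * w2 \<in> \<Delta>''"
      using c(2) by (auto elim!: eventually_mono)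
    then show "\<Delta> = \<Delta>'" using eventually_region_unique w1 w2 c(1) by metis
  qed
  from theI'[OF this] show ?thesis
    unfolding source_region_def a_def[symmetric] b_def[symmetric] C_def by (simp add: conj_assoc)
qed

end

section \<open>Colorings of regions along a transverse path\<close>

text \<open>Both limits are taken over positive \<open>h\<close>, the parameter of the cones;
  looking back along the path reverses the direction to \<open>- w\<close>.\<close>

lemma diff_quotients:
  fixes \<beta> :: "real \<Rightarrow> complex"
  assumes "(\<beta> has_vector_derivative w) (at s)"
  shows "((\<lambda>h. (\<beta> (s + h) - \<beta> s) / of_real h) \<longlongrightarrow> w) (at_right 0)"
    and "((\<lambda>h. (\<beta> (s - h) - \<beta> s) / of_real h) \<longlongrightarrow> - w) (at_right (0::real))"
proof -
  have *: "((\<lambda>h. (\<beta> (s + h) - \<beta> s) / of_real h) \<longlongrightarrow> w) (at 0)"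
  proof -
    have "((\<lambda>h. norm (\<beta> (s + h) - \<beta> s - h *\<^sub>R w) / norm h) \<longlongrightarrow> 0) (at 0)"
      using assms by (simp add: has_vector_derivative_def has_derivative_at)
    moreover have "\<forall>\<^sub>F h in at 0. norm (\<beta> (s + h) - \<beta> s - h *\<^sub>R w) / norm h
        = norm ((\<beta> (s + h) - \<beta> s) / of_real h - w)"
      unfolding eventually_at_filter
    proof (intro always_eventually allI impI)
      fix h :: real assume "h \<noteq> 0"
      then have "(\<beta> (s + h) - \<beta> s) / of_real h - w = (\<beta> (s + h) - \<beta> s - h *\<^sub>R w) / of_real h"
        by (simp add: diff_divide_distrib scaleR_conv_of_real)
      then show "norm (\<beta> (s + h) - \<beta> s - h *\<^sub>R w) / norm h
        = norm ((\<beta> (s + h) - \<beta> s) / of_real h - w)"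
        by (simp add: norm_divide)
    qed
    ultimately have "((\<lambda>h. norm ((\<beta> (s + h) - \<beta> s) / of_real h - w)) \<longlongrightarrow> 0) (at 0)"
      by (rule Lim_transform_eventually)
    then show ?thesis by (simp add: tendsto_norm_zero_iff flip: LIM_zero_iff[of _ w])
  qed
  show "((\<lambda>h. (\<beta> (s + h) - \<beta> s) / of_real h) \<longlongrightarrow> w) (at_right 0)"
    using * by (rule tendsto_mono[rotated]) (simp add: at_le)
  have "((\<lambda>h. (\<beta> (s + h) - \<beta> s) / of_real h) \<longlongrightarrow> w) (at_left 0)"
    using * by (rule tendsto_mono[rotated]) (simp add: at_le)
  then have "((\<lambda>h. (\<beta> (s - h) - \<beta> s) / of_real (- h)) \<longlongrightarrow> w) (at_right 0)"
    by (subst (asm) at_left_minus) (simp add: filterlim_filtermap)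
  then have "((\<lambda>h. - ((\<beta> (s - h) - \<beta> s) / of_real (- h))) \<longlongrightarrow> - w) (at_right 0)"
    by (rule tendsto_minus)
  moreover have "(\<lambda>h. - ((\<beta> (s - h) - \<beta> s) / of_real (- h))) = (\<lambda>h. (\<beta> (s - h) - \<beta> s) / of_real h)"
    by (simp add: fun_eq_iff)
  ultimately show "((\<lambda>h. (\<beta> (s - h) - \<beta> s) / of_real h) \<longlongrightarrow> - w) (at_right (0::real))"
    by simp
qed

context planar_diagram begin

text \<open>The secant directions eventually lie in a small compact ball around \<open>w\<close>
  inside the open left half-plane, and the cone over that ball lies in the left region uniformly in
  its directions.\<close>

lemma left_approach:
  assumes q: "q \<in> params D" "regular D q" "pt D q \<notin> crossings D"
    and w: "0 < cross2 (vel D q) w"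
    and lim: "((\<lambda>h. (f h - pt D q) / of_real h) \<longlongrightarrow> w) (at_right (0::real))"
  shows "\<forall>\<^sub>F h in at_right 0. f h \<in> left_region D q"
proof -
  have "open {k. 0 < cross2 (vel D q) k}"
    unfolding cross2_def by (intro open_Collect_less continuous_intros)
  with w obtain r where r: "r > 0" "cball w r \<subseteq> {k. 0 < cross2 (vel D q) k}"
    by (auto simp: open_contains_cball)
  have "\<forall>\<^sub>F h in at_right 0. \<forall>k\<in>cball w r. pt D q + of_real h * k \<in> left_region D q"
    using r(2) by (intro left_cone q) auto
  moreover have "\<forall>\<^sub>F h in at_right 0. dist ((f h - pt D q) / of_real h) w < r"
    using tendstoD[OF lim r(1)] .
  moreover have "\<forall>\<^sub>F h in at_right (0::real). 0 < h" by (rule eventually_at_right_less)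
  ultimately show ?thesis
  proof eventually_elim
    case (elim h)
    have "pt D q + of_real h * ((f h - pt D q) / of_real h) = f h" using elim(3) by simp
    moreover have "(f h - pt D q) / of_real h \<in> cball w r" using elim(2) by (simp add: dist_commute)
    ultimately show ?case using elim(1) by metis
  qed
qed

lemma right_approach:
  assumes q: "q \<in> params D" "regular D q" "pt D q \<notin> crossings D"
    and w: "cross2 (vel D q) w < 0"
    and lim: "((\<lambda>h. (f h - pt D q) / of_real h) \<longlongrightarrow> w) (at_right (0::real))"
  shows "\<forall>\<^sub>F h in at_right 0. f h \<in> right_region D q"
proof -
  have "open {k. cross2 (vel D q) k < 0}"
    unfolding cross2_def by (intro open_Collect_less continuous_intros)
  with w obtain r where r: "r > 0" "cball w r \<subseteq> {k. cross2 (vel D q) k < 0}"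
    by (auto simp: open_contains_cball)
  have "\<forall>\<^sub>F h in at_right 0. \<forall>k\<in>cball w r. pt D q + of_real h * k \<in> right_region D q"
    using r(2) by (intro right_cone q) auto
  moreover have "\<forall>\<^sub>F h in at_right 0. dist ((f h - pt D q) / of_real h) w < r"
    using tendstoD[OF lim r(1)] .
  moreover have "\<forall>\<^sub>F h in at_right (0::real). 0 < h" by (rule eventually_at_right_less)
  ultimately show ?thesis
  proof eventually_elim
    case (elim h)
    have "pt D q + of_real h * ((f h - pt D q) / of_real h) = f h" using elim(3) by simp
    moreover have "(f h - pt D q) / of_real h \<in> cball w r" using elim(2) by (simp add: dist_commute)
    ultimately show ?case using elim(1) by metis
  qed
qed

text \<open>This is the shadow condition for \<open>int_act\<close>; since that action ignores its
  second argument, the arc colors drop out.\<close>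

definition unit_jump :: "(complex set \<Rightarrow> int) \<Rightarrow> bool" where
  "unit_jump S \<longleftrightarrow> (\<forall>q\<in>params D. regular D q \<and> pt D q \<notin> crossings D \<longrightarrow>
     S (left_region D q) = S (right_region D q) + 1)"

text \<open>The color is constant between meeting times, as the path stays in one region there, and
  each meeting time contributes its sign. The sum telescopes.\<close>

lemma region_index_difference:
  assumes S: "unit_jump S" and \<beta>: "transverse_path D \<beta>"
    and \<Delta>: "\<Delta> \<in> regions D" "pathstart \<beta> \<in> \<Delta>" and \<Delta>': "\<Delta>' \<in> regions D" "pathfinish \<beta> \<in> \<Delta>'"
  shows "S \<Delta> - S \<Delta>' = intersection_number D \<beta>"
proof -
  let ?M = "meeting_times D \<beta>"
  define \<sigma> :: "real \<Rightarrow> int" where "\<sigma> s = (if cross2 (vel D (param_of D (\<beta> s))) (vector_derivative \<beta> (at s)) < 0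
     then 1 else - 1)" for s
  have fin: "finite ?M" and pth: "path \<beta>" using \<beta> by (simp_all add: transverse_path_def)
  \<comment> \<open>Here \<open>L\<close> and \<open>R\<close> are the regions before and after the
    passage, not the left and right ones, so both directions of crossing take the same form.\<close>
  have step: "\<forall>\<^sub>F h in at_right 0. \<exists>L\<in>regions D. \<exists>R\<in>regions D. \<beta> (s - h) \<in> L \<and> \<beta> (s + h) \<in> R \<and> S L - S R = \<sigma> s"
    if s: "s \<in> ?M" for s
  proof -
    define w where "w = vector_derivative \<beta> (at s)"
    obtain q where q: "q \<in> params D" "\<beta> s = pt D q"
      using s by (auto simp: meeting_times_def diagram_image_def)
    have tr: "\<beta> s \<notin> crossings D" "regular D (param_of D (\<beta> s))" "\<beta> differentiable (at s)"
      "cross2 (vel D (param_of D (\<beta> s))) w \<noteq> 0"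
      using \<beta> s by (auto simp: transverse_path_def w_def)
    have pq: "param_of D (\<beta> s) = q" using param_of_eq[OF q(1)] tr(1) q(2) by simp
    have q3: "regular D q" "pt D q \<notin> crossings D" and cw: "cross2 (vel D q) w \<noteq> 0" using tr pq q by auto
    have "(\<beta> has_vector_derivative w) (at s)" using tr(3) by (simp add: w_def vector_derivative_works)
    note dq = diff_quotients[OF this, unfolded q(2)]
    have jump: "S (left_region D q) = S (right_region D q) + 1"
      using S q(1) q3 by (auto simp: unit_jump_def)
    note lr = left_region_in_regions[OF q(1) q3] right_region_in_regions[OF q(1) q3]
    show ?thesis
    proof (cases "cross2 (vel D q) w < 0")
      case True
      then have \<sigma>: "\<sigma> s = 1" by (simp add: \<sigma>_def pq w_def)
      have "\<forall>\<^sub>F h in at_right 0. \<beta> (s + h) \<in> right_region D q"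
        using right_approach[OF q(1) q3 True dq(1)] .
      moreover have "\<forall>\<^sub>F h in at_right 0. \<beta> (s - h) \<in> left_region D q"
        using True by (intro left_approach[OF q(1) q3 _ dq(2)]) (simp add: cross2_minus_right)
      ultimately show ?thesis
        by eventually_elim (use jump lr \<sigma> in force)
    next
      case False
      then have \<sigma>: "\<sigma> s = - 1" by (simp add: \<sigma>_def pq w_def)
      have "\<forall>\<^sub>F h in at_right 0. \<beta> (s + h) \<in> left_region D q"
        using False cw by (intro left_approach[OF q(1) q3 _ dq(1)]) auto
      moreover have "\<forall>\<^sub>F h in at_right 0. \<beta> (s - h) \<in> right_region D q"
        using False cw by (intro right_approach[OF q(1) q3 _ dq(2)]) (simp add: cross2_minus_right)
      ultimately show ?thesis
        by eventually_elim (use jump lr \<sigma> in force)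
    qed
  qed
  \<comment> \<open>Generalized to subintervals whose ends lie off the diagram: cutting out one
    meeting time leaves two of this kind, each with fewer meeting times.\<close>
  have tele: "S L - S R = (\<Sum>s\<in>?M \<inter> {a..b}. \<sigma> s)"
    if "0 \<le> a" "a \<le> b" "b \<le> 1" "L \<in> regions D" "R \<in> regions D" "\<beta> a \<in> L" "\<beta> b \<in> R" for a b L R
    using that
  proof (induction "card (?M \<inter> {a..b})" arbitrary: a b L R rule: less_induct)
    case less
    have ends: "a \<notin> ?M" "b \<notin> ?M" using less.prems region_subset by (auto simp: meeting_times_def)
    show ?case
    proof (cases "?M \<inter> {a..b} = {}")
      case True
      have "connected (\<beta> ` {a..b})"
        using pth less.prems unfolding path_def
        by (intro connected_continuous_image continuous_on_subset[where s = "{0..1}" and t = "{a..b}"]) auto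
      moreover have "\<beta> ` {a..b} \<inter> diagram_image D = {}"
      proof -
        have "x \<in> ?M" if "x \<in> {a..b}" "\<beta> x \<in> diagram_image D" for x
          using that less.prems(1,3) by (simp add: meeting_times_def)
        with True show ?thesis by blast
      qed
      ultimately obtain \<Gamma> where \<Gamma>: "\<Gamma> \<in> regions D" "\<beta> ` {a..b} \<subseteq> \<Gamma>"
        using connected_in_region[of "\<beta> ` {a..b}"] less.prems(2) by auto
      then have "\<beta> a \<in> \<Gamma>" "\<beta> b \<in> \<Gamma>" using less.prems(2) by auto
      then have "L = \<Gamma>" "R = \<Gamma>"
        using region_unique[OF less.prems(4) \<Gamma>(1) less.prems(6)]
          region_unique[OF less.prems(5) \<Gamma>(1) less.prems(7)] by simp_all
      then show ?thesis using True by simp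
    next
      case False
      then obtain s where s: "s \<in> ?M" "a \<le> s" "s \<le> b" by auto
      then have sab: "a < s" "s < b" using ends by (auto simp: less_le)
      obtain d where d: "d > 0" "\<And>x. x \<in> ?M \<Longrightarrow> x \<noteq> s \<Longrightarrow> d \<le> dist s x"
        using finite_set_avoid[OF fin, of s] by blast
      \<comment> \<open>\<open>d\<close> keeps the other meeting times out of the gap around
        \<open>s\<close>; the other two bounds keep both remaining intervals inside [a,b].\<close>
      have "\<forall>\<^sub>F h in at_right 0. h < min d (min (s - a) (b - s))"
        using d(1) sab by (intro eventually_at_right_0_I[of "min d (min (s - a) (b - s))"]) auto
      with step[OF s(1)] have "\<forall>\<^sub>F h in at_right 0. (\<exists>L\<in>regions D. \<exists>R\<in>regions D. \<beta> (s - h) \<in> L \<and>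
         \<beta> (s + h) \<in> R \<and> S L - S R = \<sigma> s) \<and> h < min d (min (s - a) (b - s)) \<and> 0 < h"
        using eventually_at_right_less[of "0::real"] by eventually_elim blast
      then obtain h L' R' where h: "L' \<in> regions D" "R' \<in> regions D" "\<beta> (s - h) \<in> L'" "\<beta> (s + h) \<in> R'"
        "S L' - S R' = \<sigma> s" "h < d" "h < s - a" "h < b - s" "0 < h"
        using eventually_happens'[OF trivial_limit_at_right_real] by force
      have near: "x = s \<or> x \<le> s - h \<or> s + h \<le> x" if "x \<in> ?M" for x
        using d(2)[OF that] h(6) by (auto simp: dist_real_def)
      let ?M1 = "?M \<inter> {a..s - h}" and ?M2 = "?M \<inter> {s + h..b}"
      have split: "?M \<inter> {a..b} = insert s (?M1 \<union> ?M2)"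
      proof (rule Set.set_eqI)
        fix x
        show "x \<in> ?M \<inter> {a..b} \<longleftrightarrow> x \<in> insert s (?M1 \<union> ?M2)"
          using near[of x] s(1) sab h(7-9) by auto
      qed
      have fins: "finite (?M \<inter> {x..y})" for x y using fin by simp
      have s12: "s \<notin> ?M1 \<union> ?M2" "?M1 \<inter> ?M2 = {}" using h(9) by auto
      then have "?M1 \<subset> ?M \<inter> {a..b}" "?M2 \<subset> ?M \<inter> {a..b}" unfolding split by blast+
      then have c1: "card ?M1 < card (?M \<inter> {a..b})" and c2: "card ?M2 < card (?M \<inter> {a..b})"
        using fins by (simp_all only: psubset_card_mono)
      have e1: "S L - S L' = (\<Sum>s\<in>?M \<inter> {a..s - h}. \<sigma> s)"
        using less.prems h by (intro less.hyps[OF c1]) auto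
      have e2: "S R' - S R = (\<Sum>s\<in>?M \<inter> {s + h..b}. \<sigma> s)"
        using less.prems h by (intro less.hyps[OF c2]) auto
      have "(\<Sum>s\<in>?M \<inter> {a..b}. \<sigma> s) = \<sigma> s + ((\<Sum>s\<in>?M1. \<sigma> s) + (\<Sum>s\<in>?M2. \<sigma> s))"
        unfolding split using fins s12 by (simp add: sum.union_disjoint)
      then show ?thesis using e1 e2 h(5) by simp
    qed
  qed
  have "?M \<inter> {0..1} = ?M" by (auto simp: meeting_times_def)
  then show ?thesis
    using tele[of 0 1 \<Delta> \<Delta>'] \<Delta> \<Delta>' by (simp add: pathstart_def pathfinish_def intersection_number_def \<sigma>_def)
qed

end


section \<open>Generic horizontal paths\<close>

text \<open>Sard's theorem on the line. \<open>vec\<close> and \<open>$ 1\<close> transport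
  \<open>g\<close> to \<open>real^1\<close>, where \<open>baby_Sard\<close> applies because the zero
  derivative has rank 0 < 1.\<close>

lemma negligible_critical_values:
  fixes g :: "real \<Rightarrow> real"
  assumes "\<And>t. t \<in> S \<Longrightarrow> (g has_real_derivative 0) (at t)"
  shows "negligible (g ` S)"
proof -
  let ?f = "\<lambda>x :: real^1. (vec (g (x $ 1)) :: real^1)"
  let ?T = "{x :: real^1. x $ 1 \<in> S}"
  have der: "(?f has_derivative (\<lambda>h. 0)) (at x)" if "x \<in> ?T" for x
  proof -
    have 1: "((\<lambda>x :: real^1. x $ 1) has_derivative (\<lambda>h. h $ 1)) (at x)"
      by (rule bounded_linear_imp_has_derivative) (rule bounded_linear_vec_nth)
    have 2: "(g has_derivative (\<lambda>h. 0)) (at (x $ 1))"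
      by (rule has_derivative_eq_rhs)
         (use assms[of "x $ 1"] that in \<open>auto simp: has_field_derivative_def fun_eq_iff\<close>)
    have 3: "bounded_linear (vec :: real \<Rightarrow> real^1)"
      by (intro linear_conv_bounded_linear[THEN iffD1] linearI) (simp_all add: vec_eq_iff)
    have "((\<lambda>x. g (x $ 1)) has_derivative (\<lambda>h. 0)) (at x)"
      using diff_chain_at[OF 1 2] by (simp add: o_def)
    from bounded_linear.has_derivative[OF 3 this] show ?thesis
      by (simp add: linear_0[OF bounded_linear.linear[OF 3]])
  qed
  have "negligible (?f ` ?T)"
  proof (rule baby_Sard)
    show "(?f has_derivative (\<lambda>h. 0)) (at x within ?T)" if "x \<in> ?T" for x
      using der[OF that] by (rule has_derivative_at_withinI)
    have "matrix (\<lambda>h :: real^1. 0 :: real^1) = 0"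
      by (simp add: matrix_def vec_eq_iff)
    then show "rank (matrix (\<lambda>h :: real^1. 0 :: real^1)) < CARD(1)"
      by simp
  qed simp
  then have "negligible ((\<lambda>y :: real^1. y $ 1) ` ?f ` ?T)"
    by (rule negligible_differentiable_image_negligible[rotated])
       (auto intro: bounded_linear_imp_differentiable_on bounded_linear_vec_nth)
  moreover have "(\<lambda>y :: real^1. y $ 1) ` ?f ` ?T = g ` S"
  proof -
    have "g t \<in> (\<lambda>y :: real^1. y $ 1) ` ?f ` ?T" if "t \<in> S" for t
      using that by (intro image_eqI[of _ _ "?f (vec t)"] imageI) auto
    then show ?thesis by auto
  qed
  ultimately show ?thesis by simp
qed

text \<open>A solution is isolated by its nonzero derivative and a non-solution by continuity;
  bisection of the compact interval then leaves finitely many.\<close>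

lemma finite_level_set:
  fixes g :: "real \<Rightarrow> real"
  assumes cont: "continuous_on UNIV g"
    and der: "\<And>t. g t = y \<Longrightarrow> \<exists>g'. (g has_real_derivative g') (at t) \<and> g' \<noteq> 0"
  shows "finite {t \<in> {0..1}. g t = y}"
proof -
  have "finite {t \<in> {a..b}. g t = y}" if "a \<le> b" for a b
    using that
  proof (rule Bolzano[where P = "\<lambda>a b. finite {t \<in> {a..b}. g t = y}"])
    fix a b c :: real assume "finite {t \<in> {a..b}. g t = y}" "finite {t \<in> {b..c}. g t = y}"
    then have "finite ({t \<in> {a..b}. g t = y} \<union> {t \<in> {b..c}. g t = y})" by simp
    then show "finite {t \<in> {a..c}. g t = y}" by (rule rev_finite_subset) auto
  next
    fix x
    have "\<forall>\<^sub>F t in at x. g t \<noteq> y"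
    proof (cases "g x = y")
      case True
      then obtain g' where g': "(g has_real_derivative g') (at x)" "g' \<noteq> 0" using der by blast
      then have "((\<lambda>t. (g t - g x) / (t - x)) \<longlongrightarrow> g') (at x)"
        by (simp add: has_field_derivative_iff)
      from tendsto_imp_eventually_ne[OF this g'(2)] show ?thesis
        by eventually_elim (use True in auto)
    next
      case False
      have "(g \<longlongrightarrow> g x) (at x)"
        using cont by (simp add: continuous_on_eq_continuous_at continuous_at)
      from tendsto_imp_eventually_ne[OF this False] show ?thesis .
    qed
    then obtain d where d: "d > 0" "\<And>t. t \<noteq> x \<Longrightarrow> dist t x < d \<Longrightarrow> g t \<noteq> y"
      by (auto simp: eventually_at)
    show "\<exists>d>0. \<forall>a b. a \<le> x \<and> x \<le> b \<and> b - a < d \<longrightarrow> finite {t \<in> {a..b}. g t = y}"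
    proof (intro exI[of _ d] conjI allI impI)
      fix a b assume ab: "a \<le> x \<and> x \<le> b \<and> b - a < d"
      have "t = x" if "t \<in> {a..b}" "g t = y" for t
      proof (rule ccontr)
        assume "t \<noteq> x"
        moreover have "dist t x < d" using that(1) ab by (auto simp: dist_real_def)
        ultimately show False using d(2) that(2) by blast
      qed
      then have "{t \<in> {a..b}. g t = y} \<subseteq> {x}" by blast
      then show "finite {t \<in> {a..b}. g t = y}" by (rule finite_subset) simp
    qed (rule d)
  qed
  then show ?thesis by simp
qed

context planar_diagram begin

lemma exists_transverse_path:
  assumes \<Delta>: "\<Delta> \<in> regions D"
  shows "\<exists>\<beta>. transverse_path D \<beta> \<and> pathstart \<beta> \<in> \<Delta> \<and> pathfinish \<beta> \<in> exterior_region D"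
proof -
  define crit where "crit i = {t. regular D (i, frac t) \<and> Im (vel D (i, frac t)) = 0}" for i
  \<comment> \<open>Heights at which a horizontal line could meet a crossing, a corner or a
    horizontal tangent. The first two kinds are finite in number, the third is negligible by
    Sard.\<close>
  define bad where "bad = Im ` crossings D \<union> (Im \<circ> pt D) ` {q \<in> params D. \<not> regular D q} \<union>
     (\<Union>i<ncomp D. (\<lambda>t. Im (curve D i t)) ` crit i)"
  have Im_deriv: "((\<lambda>t. Im (curve D i t)) has_real_derivative Im (vel D (i, frac t))) (at t)"
    if "i < ncomp D" "regular D (i, frac t)" for i t
    using curve_deriv[OF that] unfolding has_real_derivative_iff_has_vector_derivative
    by (rule bounded_linear.has_vector_derivative[OF bounded_linear_Im])
  have "negligible ((\<lambda>t. Im (curve D i t)) ` crit i)" if "i < ncomp D" for i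
  proof (rule negligible_critical_values)
    fix t assume "t \<in> crit i"
    then show "((\<lambda>t. Im (curve D i t)) has_real_derivative 0) (at t)"
      using Im_deriv[OF that, of t] by (simp add: crit_def)
  qed
  then have "negligible bad"
    unfolding bad_def using finite_crossings finite_nonregular
    by (intro negligible_Un negligible_Union) (auto intro: negligible_finite)
  obtain p0 where p0: "p0 \<in> \<Delta>" using region_nonempty[OF \<Delta>] by blast
  then obtain e where e: "e > 0" "ball p0 e \<subseteq> \<Delta>" using region_open[OF \<Delta>] by (auto simp: open_contains_ball)
  \<comment> \<open>A nonempty open interval is not negligible, so the starting point can be moved
    vertically within \<Delta> to a generic height.\<close>
  have "\<not> {Im p0 - e<..<Im p0 + e} \<subseteq> bad"
  proof
    assume "{Im p0 - e<..<Im p0 + e} \<subseteq> bad"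
    then have "negligible {Im p0 - e<..<Im p0 + e}" by (rule negligible_subset[OF \<open>negligible bad\<close>])
    with open_not_negligible[OF open_greaterThanLessThan, of "Im p0 - e" "Im p0 + e"] e(1)
    show False by simp
  qed
  then obtain y where y': "y \<in> {Im p0 - e<..<Im p0 + e}" and y: "y \<notin> bad" by blast
  define p where "p = Complex (Re p0) y"
  have "cmod (p0 - p) = \<bar>y - Im p0\<bar>" by (simp add: p_def cmod_def)
  then have p: "p \<in> \<Delta>" using e(2) y' by (auto simp: dist_norm subset_iff)
  have reg: "regular D q \<and> Im (vel D q) \<noteq> 0 \<and> pt D q \<notin> crossings D"
    if q: "q \<in> params D" "Im (pt D q) = y" for q
  proof -
    have "Im (pt D q) \<notin> bad" using y q(2) by simp
    then have n: "pt D q \<notin> crossings D" "q \<notin> {q \<in> params D. \<not> regular D q}"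
      "\<And>i t. i < ncomp D \<Longrightarrow> t \<in> crit i \<Longrightarrow> Im (pt D q) \<noteq> Im (curve D i t)"
      unfolding bad_def by force+
    have "regular D q" using n(2) q(1) by simp
    moreover have "frac (snd q) = snd q" "fst q < ncomp D" using q(1) by (auto simp: params_def frac_eq)
    moreover from this have "snd q \<notin> crit (fst q)" using n(3) by (metis pt_def)
    ultimately show ?thesis using n(1) by (simp add: crit_def)
  qed
  obtain B where B: "B > 0" "\<And>z. cmod z > B \<Longrightarrow> z \<in> exterior_region D" using far_in_exterior by blast
  \<comment> \<open>Long enough that the end \<open>p + T\<close> has modulus at least
    \<open>B + 1\<close>.\<close>
  define T where "T = B + cmod p + 1"
  have T: "T > 0" using B(1) by (simp add: T_def add_pos_nonneg)
  define \<beta> where "\<beta> t = p + of_real (t * T)" for t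
  have der: "(\<beta> has_vector_derivative of_real T) (at t)" for t
    unfolding \<beta>_def by (auto intro!: derivative_eq_intros)
  have level: "finite {t \<in> {0..1}. Im (curve D i t) = y}" if i: "i < ncomp D" for i
  proof (rule finite_level_set)
    show "continuous_on UNIV (\<lambda>t. Im (curve D i t))" by (intro continuous_intros cont_curve i)
    fix t assume "Im (curve D i t) = y"
    then show "\<exists>g'. ((\<lambda>t. Im (curve D i t)) has_real_derivative g') (at t) \<and> g' \<noteq> 0"
      using Im_deriv[OF i, of t] reg[of "(i, frac t)"] params_frac[OF i, of t] pt_frac[OF i, of t] by auto
  qed
  have "transverse_path D \<beta>"
    unfolding transverse_path_def
  proof (intro conjI ballI)
    show "path \<beta>" unfolding path_def \<beta>_def by (intro continuous_intros)
    \<comment> \<open>The displayed map recovers the time from the point of the path, so finiteness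
      of the level sets passes to the meeting times.\<close>
    have "meeting_times D \<beta> \<subseteq> (\<lambda>z. (Re z - Re p) / T) ` (\<Union>i<ncomp D. curve D i ` {t \<in> {0..1}. Im (curve D i t) = y})"
    proof
      fix s assume s: "s \<in> meeting_times D \<beta>"
      then obtain i t where it: "i < ncomp D" "t \<in> {0..1}" "\<beta> s = curve D i t"
        by (auto simp: meeting_times_def diagram_image_eq)
      have "Im (\<beta> s) = y" by (simp add: \<beta>_def p_def)
      with it have "\<beta> s \<in> (\<Union>i<ncomp D. curve D i ` {t \<in> {0..1}. Im (curve D i t) = y})" by auto
      moreover have "s = (Re (\<beta> s) - Re p) / T" using T by (simp add: \<beta>_def)
      ultimately show "s \<in> (\<lambda>z. (Re z - Re p) / T) ` (\<Union>i<ncomp D. curve D i ` {t \<in> {0..1}. Im (curve D i t) = y})"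
        by (rule image_eqI[rotated])
    qed
    then show "finite (meeting_times D \<beta>)" by (rule finite_subset) (use level in auto)
  next
    fix s assume s: "s \<in> meeting_times D \<beta>"
    then obtain q where q: "q \<in> params D" "\<beta> s = pt D q" by (auto simp: meeting_times_def diagram_image_def)
    have "Im (pt D q) = y" unfolding q(2)[symmetric] by (simp add: \<beta>_def p_def)
    note rq = reg[OF q(1) this]
    have pq: "param_of D (\<beta> s) = q" using param_of_eq[OF q(1)] rq q(2) by simp
    show "\<beta> s \<notin> crossings D" "regular D (param_of D (\<beta> s))" using rq pq q(2) by auto
    show "\<beta> differentiable (at s)" using der by (rule differentiableI_vector)
    show "cross2 (vel D (param_of D (\<beta> s))) (vector_derivative \<beta> (at s)) \<noteq> 0"
      using rq T vector_derivative_at[OF der, of s] by (simp add: pq cross2_def)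
  qed
  moreover have "pathstart \<beta> \<in> \<Delta>" using p by (simp add: pathstart_def \<beta>_def)
  moreover have "pathfinish \<beta> \<in> exterior_region D"
  proof -
    have "cmod (of_real T) - cmod p \<le> cmod (p + of_real T)"
      using norm_diff_ineq[of "complex_of_real T" p] by (simp add: add.commute)
    moreover have "cmod (of_real T) = T" using T by simp
    ultimately have "B < cmod (p + of_real T)" by (simp only: T_def)
    then show ?thesis using B(2) by (simp add: pathfinish_def \<beta>_def)
  qed
  ultimately show ?thesis by blast
qed

end


section \<open>Winding numbers on the two sides of a strand\<close>

text \<open>A scaled Cayley transform. For \<open>e > 0\<close> it sends 0 to -1, on the branch cut
  of \<open>Ln\<close>, and the formula shows that the sign of \<open>Re u\<close> decides on which
  side of the cut the value lies.\<close>

lemma Im_cayley: "Im ((u - of_real e * \<i>) / (u + of_real e * \<i>)) = - 2 * e * Re u / (cmod (u + of_real e * \<i>))\<^sup>2"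
  unfolding Im_divide cmod_power2 by (simp add: algebra_simps power2_eq_square)

text \<open>The negated values tend to 1, where \<open>Ln\<close> is continuous with value 0. Going
  back to \<open>f\<close> shifts the logarithm by -\<i>\<pi> below the cut and by \<i>\<pi> above
  it.\<close>

lemma Ln_cayley_limit:
  assumes e: "e > 0" and u: "(u \<longlongrightarrow> 0) F"
  defines "f \<equiv> \<lambda>s. (u s - of_real e * \<i>) / (u s + of_real e * \<i>)"
  shows "\<forall>\<^sub>F s in F. 0 < Re (u s) \<Longrightarrow> ((\<lambda>s. Ln (f s)) \<longlongrightarrow> - (\<i> * pi)) F"
    and "\<forall>\<^sub>F s in F. Re (u s) < 0 \<Longrightarrow> ((\<lambda>s. Ln (f s)) \<longlongrightarrow> \<i> * pi) F"
proof -
  have "((\<lambda>s. - f s) \<longlongrightarrow> - ((0 - of_real e * \<i>) / (0 + of_real e * \<i>))) F"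
    unfolding f_def using e by (intro tendsto_intros u) auto
  then have f: "((\<lambda>s. - f s) \<longlongrightarrow> 1) F" using e by simp
  then have L: "((\<lambda>s. Ln (- f s)) \<longlongrightarrow> 0) F"
    using tendsto_Ln[OF f] by simp
  have Im_f: "Im (f s) < 0 \<longleftrightarrow> 0 < Re (u s)" "0 < Im (f s) \<longleftrightarrow> Re (u s) < 0" if "Re (u s) \<noteq> 0" for s
  proof -
    have "u s + of_real e * \<i> \<noteq> 0" using that by (auto simp: complex_eq_iff)
    then have "0 < (cmod (u s + of_real e * \<i>))\<^sup>2" by simp
    then show "Im (f s) < 0 \<longleftrightarrow> 0 < Re (u s)" "0 < Im (f s) \<longleftrightarrow> Re (u s) < 0"
      unfolding f_def Im_cayley using e
      by (simp_all add: divide_less_0_iff zero_less_divide_iff mult_less_0_iff zero_less_mult_iff)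
  qed
  show "((\<lambda>s. Ln (f s)) \<longlongrightarrow> - (\<i> * pi)) F" if "\<forall>\<^sub>F s in F. 0 < Re (u s)"
  proof (rule Lim_transform_eventually)
    show "((\<lambda>s. Ln (- f s) - \<i> * pi) \<longlongrightarrow> - (\<i> * pi)) F"
      using tendsto_diff[OF L tendsto_const[of "\<i> * pi"]] by simp
    show "\<forall>\<^sub>F s in F. Ln (- f s) - \<i> * pi = Ln (f s)" using that
    proof eventually_elim
      case (elim s)
      then have "Im (f s) < 0" using Im_f[of s] by simp
      then show ?case using Ln_minus[of "- f s"] by (auto simp: complex_eq_iff)
    qed
  qed
  show "((\<lambda>s. Ln (f s)) \<longlongrightarrow> \<i> * pi) F" if "\<forall>\<^sub>F s in F. Re (u s) < 0"
  proof (rule Lim_transform_eventually)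
    show "((\<lambda>s. Ln (- f s) + \<i> * pi) \<longlongrightarrow> \<i> * pi) F"
      using tendsto_add[OF L tendsto_const[of "\<i> * pi"]] by simp
    show "\<forall>\<^sub>F s in F. Ln (- f s) + \<i> * pi = Ln (f s)" using that
    proof eventually_elim
      case (elim s)
      then have "0 < Im (f s)" using Im_f[of s] by simp
      then show ?case using Ln_minus[of "- f s"] by (auto simp: complex_eq_iff)
    qed
  qed
qed

text \<open>Two logarithms of the same function differ by a continuous function with values in
  2\<pi>\<i> times the integers. Distinct values are more than 1 apart, so the difference is
  constant.\<close>

lemma continuous_log_unique:
  fixes p q :: "real \<Rightarrow> complex"
  assumes "continuous_on {0..1} p" "continuous_on {0..1} q"
    and "\<And>t. t \<in> {0..1} \<Longrightarrow> exp (p t) = exp (q t)"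
  shows "p 1 - p 0 = q 1 - q 0"
proof -
  let ?d = "\<lambda>t. p t - q t"
  have "?d constant_on {0..1}"
  proof (rule continuous_discrete_range_constant)
    show "continuous_on {0..1} ?d" by (intro continuous_intros assms)
    have per: "\<exists>n::int. ?d t = of_int (2 * n) * pi * \<i>" if "t \<in> {0..1}" for t
      using assms(3)[OF that] by (simp add: exp_eq) (metis add_diff_cancel_left')
    fix x :: real assume x: "x \<in> {0..1}"
    have "1 \<le> cmod (?d y - ?d x)" if y: "y \<in> {0..1}" "?d y \<noteq> ?d x" for y
    proof -
      obtain m n :: int where mn: "?d x = of_int (2 * m) * pi * \<i>" "?d y = of_int (2 * n) * pi * \<i>"
        using per x y by blast
      then have "m \<noteq> n" using y by auto
      have "?d y - ?d x = of_real (of_int (2 * (n - m)) * pi) * \<i>" unfolding mn by (simp add: algebra_simps)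
      then have "cmod (?d y - ?d x) = \<bar>of_int (2 * (n - m))\<bar> * pi"
        by (simp only: norm_mult norm_of_real abs_mult) simp
      moreover have "1 \<le> \<bar>real_of_int (2 * (n - m))\<bar>" 
      proof -
        have "1 \<le> \<bar>2 * (n - m)\<bar>" using \<open>m \<noteq> n\<close> by auto
        then show ?thesis by (simp only: of_int_abs[symmetric] of_int_1_le_iff)
      qed
      ultimately show ?thesis using pi_ge_two mult_mono[of 1 "\<bar>real_of_int (2 * (n - m))\<bar>" 1 pi] by simp
    qed
    then show "\<exists>e>0. \<forall>y. y \<in> {0..1} \<and> ?d y \<noteq> ?d x \<longrightarrow> e \<le> cmod (?d y - ?d x)"
      by (intro exI[of _ 1]) auto
  qed auto
  then have "?d 1 = ?d 0" unfolding constant_on_def by auto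
  then show ?thesis by (simp add: algebra_simps)
qed

text \<open>The difference of the two winding numbers is that of the loop \<open>(c - zl) / (c - zr)\<close> about \<open>0\<close>.
  This loop meets the negative real axis exactly where \<open>c\<close> meets the segment from \<open>zr\<close> to \<open>zl\<close>,
  that is once, at \<open>- 1\<close>; so the principal branch is a logarithm along one period, and it climbs
  from \<open>- \<i>\<pi>\<close> to \<open>\<i>\<pi>\<close>.\<close>

lemma winding_number_jump:
  fixes c :: "real \<Rightarrow> complex"
  assumes cont: "continuous_on UNIV c" and per: "\<And>t. c (t + 1) = c t" and t0: "0 \<le> t0" "t0 < 1"
    and der: "(c has_vector_derivative v) (at t0)" and v: "v \<noteq> 0" and e: "e > 0"
  defines "zl \<equiv> c t0 + of_real e * (\<i> * v)" and "zr \<equiv> c t0 - of_real e * (\<i> * v)"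
  assumes avoid: "\<And>s. t0 < s \<Longrightarrow> s < t0 + 1 \<Longrightarrow> c s \<notin> closed_segment zr zl"
  shows "winding_number c zl = winding_number c zr + 1"
proof -
  \<comment> \<open>Starting the loop at \<open>t0\<close> places its only meeting with the segment
    at the two ends of the parameter interval.\<close>
  define g where "g = (\<lambda>s. c (t0 + s))"
  have cg: "continuous_on S g" for S
    unfolding g_def by (rule continuous_on_compose2[OF cont]) (auto intro!: continuous_intros)
  have pc: "path c" unfolding path_def using cont by (rule continuous_on_subset) auto
  have loop: "pathfinish c = pathstart c" using per[of 0] by (simp add: pathfinish_def pathstart_def)
  have t0': "t0 \<in> {0..1}" using t0 by simp
  have g_shift: "g = shiftpath t0 c"
    using per[of "t0 + s - 1" for s] by (auto simp: g_def shiftpath_def fun_eq_iff)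
  have g01: "g 0 = c t0" "g 1 = c t0" using per[of t0] by (simp_all add: g_def)
  have ne: "zl \<noteq> c t0" "zr \<noteq> c t0" using e v by (simp_all add: zl_def zr_def)
  have gne: "g s \<noteq> zl" "g s \<noteq> zr" if "s \<in> {0..1}" for s
  proof -
    have "s = 0 \<or> s = 1 \<or> g s \<notin> closed_segment zr zl" using avoid[of "t0 + s"] that by (auto simp: g_def)
    then show "g s \<noteq> zl" "g s \<noteq> zr" using g01 ne by auto
  qed
  have pg: "path g" using cg by (simp add: path_def)
  have img: "path_image g = path_image c" unfolding g_shift
    by (intro path_image_shiftpath t0' loop)
  have nin: "zl \<notin> path_image g" "zr \<notin> path_image g" using gne unfolding path_image_def by blast+
  have wn: "winding_number g z = winding_number c z" if "z \<notin> path_image g" for z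
    using winding_number_shiftpath[OF pc _ loop t0'] that img by (simp add: g_shift)
  obtain ql where ql: "path ql" "pathfinish ql - pathstart ql = 2 * of_real pi * \<i> * winding_number g zl"
    "\<And>t. t \<in> {0..1} \<Longrightarrow> g t = zl + exp (ql t)" using winding_number_as_continuous_log[OF pg nin(1)] by blast
  obtain qr where qr: "path qr" "pathfinish qr - pathstart qr = 2 * of_real pi * \<i> * winding_number g zr"
    "\<And>t. t \<in> {0..1} \<Longrightarrow> g t = zr + exp (qr t)" using winding_number_as_continuous_log[OF pg nin(2)] by blast
  define f where "f s = (g s - zl) / (g s - zr)" for s
  \<comment> \<open>Coordinate in which the strand passes 0 in direction 1, with \<open>zl\<close>
    and \<open>zr\<close> at \<open>e * \<i>\<close> and \<open>- e * \<i>\<close>.\<close>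
  define u where "u s = (g s - c t0) / v" for s
  have fu: "f s = (u s - of_real e * \<i>) / (u s + of_real e * \<i>)" for s
  proof -
    have "v * u s = g s - c t0" using v by (simp add: u_def)
    then have "g s - zl = v * (u s - of_real e * \<i>)" "g s - zr = v * (u s + of_real e * \<i>)"
      by (simp_all add: zl_def zr_def algebra_simps)
    then show ?thesis using v by (simp add: f_def)
  qed
  \<comment> \<open>At both ends \<open>f\<close> is -1, on the branch cut; the prescribed values
    are the one-sided limits, so that \<open>h\<close> becomes continuous.\<close>
  define h where "h s = (if s = 0 then - (\<i> * pi) else if s = 1 then \<i> * pi else Ln (f s))" for s
  \<comment> \<open>A quotient \<open>- r\<close> with \<open>r \<ge> 0\<close> makes
    \<open>g s\<close> the convex combination of \<open>zr\<close> and \<open>zl\<close> with weight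
    \<open>1 / (1 + r)\<close> at \<open>zl\<close>.\<close>
  have f_nonpos: "f s \<notin> \<real>\<^sub>\<le>\<^sub>0" if s: "0 < s" "s < 1" for s
  proof
    assume "f s \<in> \<real>\<^sub>\<le>\<^sub>0"
    then obtain r where r: "f s = - of_real r" "0 \<le> r"
      by (metis complex_nonpos_Reals_iff complex_is_Real_iff of_real_Re minus_minus neg_0_le_iff_le of_real_minus)
    have "g s - zl = - of_real r * (g s - zr)" using r gne(2)[of s] s by (simp add: f_def field_simps)
    then have "of_real (1 + r) * g s = zl + of_real r * zr" by (simp add: algebra_simps)
    moreover have "of_real (1 + r) \<noteq> (0 :: complex)" using r(2) by (metis add_pos_nonneg of_real_eq_0_iff order_less_irrefl zero_less_one)
    ultimately have "g s = (zl + of_real r * zr) / of_real (1 + r)"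
      by (metis nonzero_mult_div_cancel_left)
    also have "\<dots> = (1 - 1 / (1 + r)) *\<^sub>R zr + (1 / (1 + r)) *\<^sub>R zl"
    proof -
      have "1 - 1 / (1 + r) = r / (1 + r)" using r(2) by (simp add: field_simps)
      then show ?thesis by (simp add: scaleR_conv_of_real add_divide_distrib)
    qed
    finally have "g s \<in> closed_segment zr zl"
      unfolding closed_segment_def using r(2) by (intro CollectI exI[of _ "1 / (1 + r)"]) auto
    then show False using avoid[of "t0 + s"] s by (simp add: g_def)
  qed
  have contf: "isCont f s" if "0 < s" "s < 1" for s
    unfolding f_def using cg[of UNIV] gne(2)[of s] that
    by (intro continuous_intros) (auto simp: continuous_on_eq_continuous_at)
  \<comment> \<open>The loop leaves in direction 1, and seen backwards from its end it recedes in
    direction -1. This fixes the sign of \<open>Re (u s)\<close> near each end, and with it the side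
    of the cut.\<close>
  have quot: "((\<lambda>s. u s / of_real s) \<longlongrightarrow> 1) (at_right 0)" "((\<lambda>s. u (1 - s) / of_real s) \<longlongrightarrow> - 1) (at_right 0)"
  proof -
    have "u s / of_real s = ((c (t0 + s) - c t0) / of_real s) / v" for s
      by (simp add: u_def g_def)
    then show "((\<lambda>s. u s / of_real s) \<longlongrightarrow> 1) (at_right 0)"
      using tendsto_divide[OF diff_quotients(1)[OF der] tendsto_const[of v]] v by simp
    have "u (1 - s) / of_real s = ((c (t0 - s) - c t0) / of_real s) / v" for s
      using per[of "t0 - s"] by (simp add: u_def g_def algebra_simps)
    then show "((\<lambda>s. u (1 - s) / of_real s) \<longlongrightarrow> - 1) (at_right 0)"
      using tendsto_divide[OF diff_quotients(2)[OF der] tendsto_const[of v]] v by simp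
  qed
  have u_lim: "(u \<longlongrightarrow> 0) (at_right 0)" "(u \<longlongrightarrow> 0) (at_left 1)"
  proof -
    have cu: "continuous_on UNIV u" unfolding u_def using v by (intro continuous_intros cg) auto
    have "u 0 = 0" "u 1 = 0" by (simp_all add: u_def g01)
    moreover have "(u \<longlongrightarrow> u s) (at s within T)" for s T
      using cu by (metis UNIV_I continuous_on_def tendsto_within_subset subset_UNIV)
    ultimately show "(u \<longlongrightarrow> 0) (at_right 0)" "(u \<longlongrightarrow> 0) (at_left 1)" by metis+
  qed
  have u_sign: "\<forall>\<^sub>F s in at_right 0. 0 < Re (u s)" "\<forall>\<^sub>F s in at_left 1. Re (u s) < 0"
  proof -
    have "\<forall>\<^sub>F s in at_right 0. 0 < Re (u s / of_real s)"
      using order_tendstoD(1)[OF tendsto_Re[OF quot(1)], of 0] by simp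
    with eventually_at_right_less[of 0] show "\<forall>\<^sub>F s in at_right 0. 0 < Re (u s)"
      by eventually_elim (simp add: zero_less_divide_iff)
    have "\<forall>\<^sub>F s in at_right 0. Re (u (1 - s) / of_real s) < 0"
      using order_tendstoD(2)[OF tendsto_Re[OF quot(2)], of 0] by simp
    with eventually_at_right_less[of 0] have "\<forall>\<^sub>F s in at_right 0. Re (u (1 - s)) < 0"
      by eventually_elim (simp add: divide_less_0_iff)
    then obtain d where d: "d > 0" "\<And>s. 0 < s \<Longrightarrow> s < d \<Longrightarrow> Re (u (1 - s)) < 0"
      by (auto simp: eventually_at_right_field)
    have "Re (u s) < 0" if "1 - d < s" "s < 1" for s using d(2)[of "1 - s"] that by simp
    then show "\<forall>\<^sub>F s in at_left 1. Re (u s) < 0"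
      using d(1) unfolding eventually_at_left_field by (intro exI[of _ "1 - d"]) auto
  qed
  have lims: "((\<lambda>s. Ln (f s)) \<longlongrightarrow> - (\<i> * pi)) (at_right 0)" "((\<lambda>s. Ln (f s)) \<longlongrightarrow> \<i> * pi) (at_left 1)"
    unfolding fu using Ln_cayley_limit[OF e] u_lim u_sign by blast+
  have h01: "h 0 = - (\<i> * pi)" "h 1 = \<i> * pi" by (simp_all add: h_def)
  have h_mid: "h s = Ln (f s)" if "0 < s" "s < 1" for s using that by (simp add: h_def)
  have conth: "continuous_on {0..1} h"
  proof (rule continuous_on_IccI)
    have ev: "\<forall>\<^sub>F s in at_right 0. Ln (f s) = h s" "\<forall>\<^sub>F s in at_left 1. Ln (f s) = h s"
      unfolding eventually_at_right_field eventually_at_left_field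
      by (rule exI[of _ 1], simp add: h_def, rule exI[of _ 0], simp add: h_def)
    show "(h \<longlongrightarrow> h 0) (at_right 0)" using Lim_transform_eventually[OF lims(1) ev(1)] by (simp only: h01)
    show "(h \<longlongrightarrow> h 1) (at_left 1)" using Lim_transform_eventually[OF lims(2) ev(2)] by (simp only: h01)
    fix s :: real assume s: "0 < s" "s < 1"
    have "((\<lambda>s. Ln (f s)) \<longlongrightarrow> Ln (f s)) (at s)"
      using contf[OF s] f_nonpos[OF s] by (intro tendsto_Ln) (auto simp: isCont_def)
    moreover have "\<forall>\<^sub>F t in at s. Ln (f t) = h t"
    proof -
      have "\<forall>\<^sub>F t in nhds s. t \<in> {0<..<1}" using s by (intro eventually_nhds_in_open) auto
      then show ?thesis unfolding eventually_at_filter by eventually_elim (auto simp: h_def)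
    qed
    ultimately have "(h \<longlongrightarrow> Ln (f s)) (at s)" by (rule Lim_transform_eventually)
    then show "(h \<longlongrightarrow> h s) (at s)" using h_mid[OF s] by (simp only:)
  qed simp
  have "(ql 1 - qr 1) - (ql 0 - qr 0) = h 1 - h 0"
  proof (rule continuous_log_unique[of "\<lambda>t. ql t - qr t"])
    show "continuous_on {0..1} (\<lambda>t. ql t - qr t)"
      using ql(1) qr(1) unfolding path_def by (rule continuous_on_diff)
    fix t :: real assume t: "t \<in> {0..1}"
    have "exp (ql t) = g t - zl" "exp (qr t) = g t - zr"
      using ql(3)[OF t] qr(3)[OF t] by (metis add_diff_cancel_left')+
    then have "exp (ql t - qr t) = f t" by (simp add: f_def exp_diff)
    moreover have "exp (h t) = f t"
    proof (cases "t = 0 \<or> t = 1")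
      case True
      then have "f t = -1" using fu[of t] g01 e by (auto simp: u_def)
      then show ?thesis using True by (auto simp: h_def exp_minus)
    next
      case False
      moreover have "f t \<noteq> 0" using gne[OF t] by (simp add: f_def)
      ultimately show ?thesis by (simp add: h_def)
    qed
    ultimately show "exp (ql t - qr t) = exp (h t)" by simp
  qed (rule conth)
  then have "2 * of_real pi * \<i> * winding_number g zl - 2 * of_real pi * \<i> * winding_number g zr = 2 * of_real pi * \<i>"
    unfolding ql(2)[symmetric] qr(2)[symmetric] by (simp add: h_def pathfinish_def pathstart_def algebra_simps)
  then have "2 * of_real pi * \<i> * (winding_number g zl - winding_number g zr) = 2 * of_real pi * \<i> * 1"
    by (simp add: algebra_simps)
  then have "winding_number g zl - winding_number g zr = 1"
    unfolding mult_cancel_left by simp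
  then show ?thesis using wn nin by (simp add: algebra_simps)
qed

section \<open>The sum of the winding numbers as an integer coloring of the regions\<close>

context planar_diagram begin

lemma path_curve: "i < ncomp D \<Longrightarrow> path (curve D i)"
  unfolding path_def using cont_curve by (rule continuous_on_subset) auto

lemma loop_curve: "i < ncomp D \<Longrightarrow> pathfinish (curve D i) = pathstart (curve D i)"
  using curve_plus_1[of i 0] by (simp add: pathfinish_def pathstart_def)

lemma path_image_curve: "i < ncomp D \<Longrightarrow> path_image (curve D i) \<subseteq> diagram_image D"
  using curve_in_image by (auto simp: path_image_def)

definition winding_sum :: "complex \<Rightarrow> complex" where
  "winding_sum z = (\<Sum>i<ncomp D. winding_number (curve D i) z)"

text \<open>The winding sum is constant on a region and is an integer of complex type; the chosen
  point, the real part and the floor only convert it to \<open>int\<close>.\<close>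

definition winding_index :: "complex set \<Rightarrow> int" where
  "winding_index \<Delta> = \<lfloor>Re (winding_sum (SOME z. z \<in> \<Delta>))\<rfloor>"

lemma winding_index:
  assumes "\<Delta> \<in> regions D" "z \<in> \<Delta>"
  shows "of_int (winding_index \<Delta>) = winding_sum z"
proof -
  define z' where "z' = (SOME z. z \<in> \<Delta>)"
  have z': "z' \<in> \<Delta>" unfolding z'_def using assms(2) by (rule someI)
  have dis: "\<Delta> \<inter> path_image (curve D i) = {}" if "i < ncomp D" for i
    using path_image_curve[OF that] region_subset[OF assms(1)] by blast
  have "winding_number (curve D i) z' = winding_number (curve D i) z" if "i < ncomp D" for i
    using winding_number_eq[OF path_curve loop_curve z' assms(2) region_connected[OF assms(1)] dis] that
    by blast
  then have eq: "winding_sum z' = winding_sum z" by (simp add: winding_sum_def)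
  have "winding_number (curve D i) z \<in> \<int>" if "i < ncomp D" for i
    using integer_winding_number[OF path_curve loop_curve] dis[OF that] assms(2) that by blast
  then have "winding_sum z \<in> \<int>" unfolding winding_sum_def by (intro Ints_sum) auto
  then obtain k where k: "winding_sum z = of_int k" by (auto elim: Ints_cases)
  then have "winding_index \<Delta> = k" unfolding winding_index_def z'_def[symmetric] eq by simp
  then show ?thesis using k by simp
qed

text \<open>A short normal segment from \<open>zr\<close> to \<open>zl\<close> meets the diagram
  only at \<open>z\<close>, and \<open>z\<close> has the one parameter \<open>q\<close>. So only the
  component through \<open>q\<close> changes its winding number; any other component misses the
  connected segment.\<close>

lemma unit_jump_winding_index: "unit_jump winding_index"
  unfolding unit_jump_def
proof (intro ballI impI)
  fix q assume q: "q \<in> params D" and q': "regular D q \<and> pt D q \<notin> crossings D"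
  obtain i t0 where it: "q = (i, t0)" by fastforce
  have i: "i < ncomp D" and t0: "0 \<le> t0" "t0 < 1" using q by (auto simp: it params_def)
  define z v where "z = pt D q" and "v = vel D q"
  have cz: "curve D i t0 = z" by (simp add: z_def pt_def it)
  have v: "v \<noteq> 0" using q' regular_vel_nz by (simp add: v_def)
  have "\<forall>\<^sub>F \<epsilon> in at_right 0. \<forall>k\<in>{\<i> * v}. z + of_real \<epsilon> * k \<in> left_region D q"
    unfolding z_def using v q' by (intro left_cone q) (auto simp: v_def cross2_i)
  moreover have "\<forall>\<^sub>F \<epsilon> in at_right 0. \<forall>k\<in>{- (\<i> * v)}. z + of_real \<epsilon> * k \<in> right_region D q"
    unfolding z_def using v q' by (intro right_cone q) (auto simp: v_def cross2_i cross2_minus_right)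
  ultimately have "\<forall>\<^sub>F \<epsilon> in at_right 0. z + of_real \<epsilon> * (\<i> * v) \<in> left_region D q \<and>
      z - of_real \<epsilon> * (\<i> * v) \<in> right_region D q"
    by eventually_elim simp
  then obtain d where d: "d > 0" "\<And>\<epsilon>. 0 < \<epsilon> \<Longrightarrow> \<epsilon> < d \<Longrightarrow>
     z + of_real \<epsilon> * (\<i> * v) \<in> left_region D q \<and> z - of_real \<epsilon> * (\<i> * v) \<in> right_region D q"
    unfolding eventually_at_right_field by auto
  define e where "e = d / 2"
  have e: "0 < e" "e < d" using d(1) by (auto simp: e_def)
  define zl zr where "zl = z + of_real e * (\<i> * v)" and "zr = z - of_real e * (\<i> * v)"
  have L: "left_region D q \<in> regions D" "zl \<in> left_region D q"
    and R: "right_region D q \<in> regions D" "zr \<in> right_region D q"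
    using left_region_in_regions[OF q] right_region_in_regions[OF q] q' d(2)[OF e]
    by (auto simp: zl_def zr_def)
  have seg: "x = z" if x: "x \<in> closed_segment zr zl" "x \<in> diagram_image D" for x
  proof -
    obtain u where u: "0 \<le> u" "u \<le> 1" "x = (1 - u) *\<^sub>R zr + u *\<^sub>R zl"
      using x(1) by (auto simp: closed_segment_def)
    \<comment> \<open>Signed position of \<open>x\<close> on the normal, with \<open>zr\<close> at
      \<open>- e\<close> and \<open>zl\<close> at \<open>e\<close>; off 0 it lies in one of the two
      regions, hence off the diagram.\<close>
    define r where "r = (2 * u - 1) * e"
    have xr: "x = z + of_real r * (\<i> * v)"
      unfolding u(3) zl_def zr_def r_def by (simp add: scaleR_conv_of_real algebra_simps)
    have "\<bar>r\<bar> \<le> 1 * e" unfolding r_def abs_mult using u(1,2) e(1) by (intro mult_mono) auto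
    then have r: "\<bar>r\<bar> < d" using e(2) by simp
    have "r = 0"
    proof (rule ccontr)
      assume "r \<noteq> 0"
      then have "x \<in> left_region D q \<or> x \<in> right_region D q"
        using d(2)[of "\<bar>r\<bar>"] r by (cases "r > 0") (auto simp: xr)
      then show False using x(2) region_subset L(1) R(1) by blast
    qed
    then show ?thesis using xr by simp
  qed
  have hit: "(j, frac s) = q" if "j < ncomp D" "curve D j s \<in> closed_segment zr zl" for j s
  proof (rule noncrossing_param_unique[OF q])
    show "pt D (j, frac s) = pt D q" using seg[OF that(2) curve_in_image[OF that(1)]] pt_frac[OF that(1)] by (simp add: z_def)
  qed (use q' params_frac[OF that(1)] in auto)
  have "winding_number (curve D j) zl = winding_number (curve D j) zr + (if j = i then 1 else 0)"
    if j: "j < ncomp D" for j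
  proof (cases "j = i")
    case True
    have "curve D i s \<notin> closed_segment zr zl" if "t0 < s" "s < t0 + 1" for s
    proof
      \<comment> \<open>A second visit within the period would put an integer strictly between 0 and
        1.\<close>
      assume "curve D i s \<in> closed_segment zr zl"
      then have "frac s = t0" using hit[OF i] by (simp add: it)
      then have "s - t0 = of_int \<lfloor>s\<rfloor>" by (simp add: frac_def)
      with that have "0 < real_of_int \<lfloor>s\<rfloor>" "real_of_int \<lfloor>s\<rfloor> < 1" by linarith+
      then have "0 < \<lfloor>s\<rfloor>" "\<lfloor>s\<rfloor> < 1" by simp_all
      then show False by simp
    qed
    moreover have "(curve D i has_vector_derivative v) (at t0)"
      using regular_deriv q' by (fastforce simp: it v_def)
    ultimately show ?thesis
      using winding_number_jump[OF cont_curve[OF i] curve_plus_1[OF i] t0 _ v e(1)] True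
      unfolding zl_def zr_def cz by simp
  next
    case False
    have "closed_segment zr zl \<inter> path_image (curve D j) = {}"
      using hit[OF j] False by (auto simp: path_image_def it)
    with False show ?thesis
      using winding_number_eq[OF path_curve[OF j] loop_curve[OF j], of zl "closed_segment zr zl" zr] by simp
  qed
  then have "winding_sum zl = winding_sum zr + (\<Sum>j<ncomp D. if j = i then 1 else 0)"
    unfolding winding_sum_def sum.distrib[symmetric] by (intro sum.cong) auto
  then have "winding_sum zl = winding_sum zr + 1" using i by simp
  then have "complex_of_int (winding_index (left_region D q)) = of_int (winding_index (right_region D q) + 1)"
    using winding_index[OF L] winding_index[OF R] by simp
  then show "winding_index (left_region D q) = winding_index (right_region D q) + 1"
    by (simp only: of_int_eq_iff)
qed

section \<open>The index as the unique integer coloring that vanishes on the exterior region\<close>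

text \<open>The right-hand side does not mention the path, so one coloring with unit jumps makes the
  description in \<open>region_index\<close> denote. With \<open>winding_index\<close> the lemma
  shows that the index itself has unit jumps; with the region coloring of a given shadow coloring it
  gives uniqueness.\<close>

lemma region_index_eq_diff:
  assumes S: "unit_jump S" and \<Delta>: "\<Delta> \<in> regions D"
  shows "region_index D \<Delta> = S \<Delta> - S (exterior_region D)"
proof -
  have *: "intersection_number D \<beta> = S \<Delta> - S (exterior_region D)"
    if "transverse_path D \<beta>" "pathstart \<beta> \<in> \<Delta>" "pathfinish \<beta> \<in> exterior_region D" for \<beta>
    using region_index_difference[OF S that(1) \<Delta> that(2) exterior_in_regions that(3)] by simp
  show ?thesis
    unfolding region_index_def
    using exists_transverse_path[OF \<Delta>] * by (intro the_equality) auto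
qed

lemma unit_jump_region_index: "unit_jump (region_index D)"
  using unit_jump_winding_index left_region_in_regions right_region_in_regions
    region_index_eq_diff[OF unit_jump_winding_index]
  by (simp add: unit_jump_def)

lemma region_index_exterior: "region_index D (exterior_region D) = 0"
  using region_index_eq_diff[OF unit_jump_winding_index exterior_in_regions] by simp

text \<open>The region part is the same for every arc coloring. It is restricted to
  \<open>regions D\<close> because shadow colorings are extensional.\<close>

lemma int_shadow_colorings:
  "{(\<C>, \<S>) \<in> shadow_colorings Q op (UNIV :: int set) int_act D. \<S> (exterior_region D) = 0}
     = (\<lambda>\<C>. (\<C>, restrict (region_index D) (regions D))) ` colorings Q op D" (is "?A = ?B")
proof (intro equalityI subsetI)
  fix x assume "x \<in> ?A"
  then obtain \<C> \<S> where x: "x = (\<C>, \<S>)" and C: "\<C> \<in> colorings Q op D"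
    and S: "\<S> \<in> regions D \<rightarrow>\<^sub>E UNIV" "\<S> (exterior_region D) = 0" and jump: "unit_jump \<S>"
    by (auto simp: shadow_colorings_def int_act_def unit_jump_def)
  have "\<S> = restrict (region_index D) (regions D)"
    by (rule PiE_ext[OF S(1)]) (use region_index_eq_diff[OF jump] S(2) in auto)
  with x C show "x \<in> ?B" by simp
next
  fix x assume "x \<in> ?B"
  then show "x \<in> ?A"
    using unit_jump_region_index region_index_exterior exterior_in_regions
      left_region_in_regions right_region_in_regions
    by (auto simp: shadow_colorings_def int_act_def unit_jump_def)
qed

end

theorem theorem4:
  fixes Q :: "'q set" and op op' :: "'q \<Rightarrow> 'q \<Rightarrow> 'q"
    and R :: "('r, 'k) ring_scheme" and A :: "('r, 'a, 'l) module_scheme"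
    and \<alpha> :: 'r and \<omega> :: "'q \<Rightarrow> 'q \<Rightarrow> 'a" and D :: diagram
  assumes "quandle Q op op'"
    and "cring R"
    and "Module.module R A"
    and "\<alpha> \<in> Units R"
    and "twisted_2_cocycle Q op R A \<alpha> \<omega>"
    and "knot_diagram D"
  shows "multisets_coincide
           (colorings Q op D) (\<lambda>\<C>. twisted_weight R A \<omega> D \<C> \<alpha>)
           {(\<C>, \<S>) \<in> shadow_colorings Q op (UNIV :: int set) int_act D.
              \<S> (exterior_region D) = 0}
           (shadow_weight A (shadow_map_of_twisted R A \<alpha> \<omega>) D)"
proof -
  interpret planar_diagram D using assms(6) by unfold_locales
  let ?h = "\<lambda>\<C> :: (nat \<times> real) set \<Rightarrow> 'q. (\<C>, restrict (region_index D) (regions D))"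
  have "bij_betw ?h (colorings Q op D) (?h ` colorings Q op D)"
    by (auto simp: bij_betw_def inj_on_def)
  \<comment> \<open>The source region of a crossing belongs to \<open>regions D\<close>, so the
    restricted index there is \<open>crossing_index\<close>, and the powers of \<alpha>
    agree.\<close>
  moreover have "twisted_weight R A \<omega> D \<C> \<alpha> = shadow_weight A (shadow_map_of_twisted R A \<alpha> \<omega>) D (?h \<C>)" for \<C>
    unfolding twisted_weight_def shadow_weight_def prod.case
    by (rule finsum_cong_on) (simp add: shadow_map_of_twisted_def crossing_index_def source_region_in_regions)
  ultimately show ?thesis
    unfolding multisets_coincide_def int_shadow_colorings by blast
qed

end
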